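(* Let $X$ be a separable real Banach space and let $G$ be a finite group of isomorphisms on $X$ such that $-\mathrm{Id}\in G$. Then $X$ admits an equivalent norm for which $G$ is equal to the group of isometries on $X$.
   Context: An isomorphism on $X$ is a bounded linear bijection of $X$ onto itself. The group of isometries on $X$ for a given norm is the group of all surjective linear isometries of $X$ onto itself for that norm. *)

theory Defs
  imports "HOL-Analysis.Analysis" "HOL-Algebra.Bij"
begin

definition isomorphism :: "('a::real_normed_vector \<Rightarrow> 'a) \<Rightarrow> bool"
  where "isomorphism T \<longleftrightarrow> bounded_linear T \<and> bij T"

(* A subgroup of BijGroup UNIV is a set of bijections containing the identity and closed
   under composition and inverses; it need not contain every isomorphism of the space. *)
definition isomorphism_group :: "('a::real_normed_vector \<Rightarrow> 'a) set \<Rightarrow> bool"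
  where "isomorphism_group G \<longleftrightarrow>
    subgroup G (BijGroup UNIV) \<and> (\<forall>T\<in>G. isomorphism T)"

definition norm_on :: "('a::real_vector \<Rightarrow> real) \<Rightarrow> bool"
  where "norm_on N \<longleftrightarrow>
    (\<forall>x. 0 \<le> N x) \<and>
    (\<forall>x. N x = 0 \<longleftrightarrow> x = 0) \<and>
    (\<forall>c x. N (c *\<^sub>R x) = \<bar>c\<bar> * N x) \<and>
    (\<forall>x y. N (x + y) \<le> N x + N y)"

(* Equivalence is with respect to the given norm of the type. *)
definition equivalent_norm :: "('a::real_normed_vector \<Rightarrow> real) \<Rightarrow> bool"
  where "equivalent_norm N \<longleftrightarrow>
    norm_on N \<and> (\<exists>c>0. \<exists>C>0. \<forall>x. c * norm x \<le> N x \<and> N x \<le> C * norm x)"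

definition isometries :: "('a::real_vector \<Rightarrow> real) \<Rightarrow> ('a \<Rightarrow> 'a) set"
  where "isometries N = {T. linear T \<and> surj T \<and> (\<forall>x. N (T x) = N x)}"

end

theory Submission
  imports Defs
begin

text \<open>
The norm that is built is
  \[ N(x) = \sum_{g\in G} \Bigl( q(gx) + \sum_n r^{n+1} |\phi_n(gx)| \Bigr), \]
  where \<open>q\<close> is an equivalent norm that is Gateaux differentiable away from \<open>0\<close> and the
  \<open>\<phi>\<^sub>n\<close> are functionals that separate points. Summing over \<open>G\<close> makes every element of \<open>G\<close> an
  isometry. That there are no others is read off from the kinks of \<open>N\<close>: since \<open>q\<close> is smooth, away from \<open>0\<close> the
  norm \<open>N\<close> fails to be differentiable exactly along the hyperplanes \<open>ker (\<phi>\<^sub>n \<circ> g)\<close>, and at a generic point of such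
  a hyperplane the jump of the derivative in direction \<open>v\<close> is a multiple of \<open>r\<^sup>n\<^sup>+\<^sup>1 \<bar>\<phi>\<^sub>n (g v)\<bar>\<close>.
  A linear isometry \<open>T\<close> preserves these jumps, so for each \<open>n\<close> there are \<open>m\<close> and \<open>h \<in> G\<close> with
  \<open>r\<^sup>n\<^sup>+\<^sup>1 \<bar>\<phi>\<^sub>n \<circ> T\<bar> = r\<^sup>m\<^sup>+\<^sup>1 \<bar>\<phi>\<^sub>m \<circ> h\<bar>\<close> (lemma \<open>isometry_transports_kernels\<close>).

  Three choices turn this into \<open>T \<in> G\<close>. The ratio \<open>r\<close> is so small that the
  weights differ by more than an isometry can distort norms, which forces \<open>m = n\<close>; as \<open>-Id \<in> G\<close>, it
  follows that \<open>\<phi>\<^sub>n \<circ> T = \<phi>\<^sub>n \<circ> g\<^sub>n\<close> with \<open>g\<^sub>n \<in> G\<close> (lemma \<open>isometry_acts_by_group\<close>). All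
  \<open>\<phi>\<^sub>n\<close> are close to \<open>\<phi>\<^sub>0\<close>, and the functionals \<open>\<phi>\<^sub>0 \<circ> g\<close> are pairwise different, which forces
  \<open>g\<^sub>n = g\<^sub>0\<close>. Finally the \<open>\<phi>\<^sub>n\<close> separate points, so \<open>T = g\<^sub>0\<close> (theorem \<open>isometries_eq_G\<close>).

  The square of \<open>q\<close> is the infimal convolution of the squares of the given norm and of a Hilbert norm
  on a dense subspace (theorem \<open>smooth_equivalent_norm\<close>). Its derivatives are the functionals needed
  to separate points, and a Baire category argument in the dual space
  provides \<open>\<phi>\<^sub>0\<close>. A space spanned by one vector has too few functionals for this scheme, but its
  isometries are \<open>\<plusminus>Id\<close> for every norm.
\<close>

section \<open>A smooth equivalent norm on a separable space\<close>

text \<open>As \<open>t\<close> decreases to \<open>0\<close> this tends, for a convex \<open>N\<close>, to the jump at \<open>x\<close> of the derivative of \<open>N\<close>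
in direction \<open>v\<close>. Every linear isometry preserves it, which is why kinks are isometric invariants.\<close>

definition second_difference :: "('a::real_vector \<Rightarrow> real) \<Rightarrow> 'a \<Rightarrow> 'a \<Rightarrow> real \<Rightarrow> real"
  where "second_difference N x v t = (N (x + t *\<^sub>R v) + N (x - t *\<^sub>R v) - 2 * N x) / t"

definition finite_support :: "(nat \<Rightarrow> real) set"
  where "finite_support = {c. finite {i. c i \<noteq> 0}}"

definition combination :: "(nat \<Rightarrow> 'a::real_vector) \<Rightarrow> (nat \<Rightarrow> real) \<Rightarrow> 'a"
  where "combination u c = (\<Sum>i | c i \<noteq> 0. c i *\<^sub>R u i)"

definition ell2 :: "(nat \<Rightarrow> real) \<Rightarrow> real"
  where "ell2 c = L2_set c {i. c i \<noteq> 0}"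

lemma combination_eq_sum:
  assumes "finite A" "{i. c i \<noteq> 0} \<subseteq> A"
  shows "combination u c = (\<Sum>i\<in>A. c i *\<^sub>R u i)"
  unfolding combination_def using assms by (intro sum.mono_neutral_left) auto

lemma ell2_eq_L2_set:
  assumes "finite A" "{i. c i \<noteq> 0} \<subseteq> A"
  shows "ell2 c = L2_set c A"
  unfolding ell2_def L2_set_def using assms
  by (intro arg_cong[where f = sqrt] sum.mono_neutral_left) auto

lemma finite_support_add:
  assumes "c \<in> finite_support" "d \<in> finite_support"
  shows "(\<lambda>i. c i + d i) \<in> finite_support"
    and "combination u (\<lambda>i. c i + d i) = combination u c + combination u d"
    and "ell2 (\<lambda>i. c i + d i) \<le> ell2 c + ell2 d"
proof -
  define A where "A = {i. c i \<noteq> 0} \<union> {i. d i \<noteq> 0}"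
  have A: "finite A" "{i. c i \<noteq> 0} \<subseteq> A" "{i. d i \<noteq> 0} \<subseteq> A" "{i. c i + d i \<noteq> 0} \<subseteq> A"
    using assms by (auto simp: A_def finite_support_def)
  show "(\<lambda>i. c i + d i) \<in> finite_support"
    using A finite_subset by (auto simp: finite_support_def)
  show "combination u (\<lambda>i. c i + d i) = combination u c + combination u d"
    using A by (simp add: combination_eq_sum[of A] scaleR_add_left sum.distrib)
  show "ell2 (\<lambda>i. c i + d i) \<le> ell2 c + ell2 d"
    using A by (simp add: ell2_eq_L2_set[of A] L2_set_triangle_ineq)
qed

lemma finite_support_scale:
  assumes "c \<in> finite_support"
  shows "(\<lambda>i. s * c i) \<in> finite_support"
    and "combination u (\<lambda>i. s * c i) = s *\<^sub>R combination u c"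
    and "ell2 (\<lambda>i. s * c i) = \<bar>s\<bar> * ell2 c"
proof -
  define A where "A = {i. c i \<noteq> 0}"
  have A: "finite A" "{i. c i \<noteq> 0} \<subseteq> A" "{i. s * c i \<noteq> 0} \<subseteq> A"
    using assms by (auto simp: A_def finite_support_def)
  show "(\<lambda>i. s * c i) \<in> finite_support"
    using A finite_subset by (auto simp: finite_support_def)
  show "combination u (\<lambda>i. s * c i) = s *\<^sub>R combination u c"
    using A(1,2) combination_eq_sum[OF A(1,3)]
    by (simp add: combination_eq_sum[of A c] scaleR_sum_right)
  show "ell2 (\<lambda>i. s * c i) = \<bar>s\<bar> * ell2 c"
    using A(1,2) ell2_eq_L2_set[OF A(1,3)] 
    by (simp add: ell2_eq_L2_set[of A c] L2_set_def power_mult_distrib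
         sum_distrib_left[symmetric] real_sqrt_mult)
qed

lemma finite_support_single:
  "(\<lambda>i. if i = j then s else 0) \<in> finite_support"
  "combination u (\<lambda>i. if i = j then s else 0) = s *\<^sub>R u j"
proof -
  have A: "{i. (if i = j then s else 0) \<noteq> 0} \<subseteq> {j}" by auto
  show "(\<lambda>i. if i = j then s else 0) \<in> finite_support"
    using A finite_subset by (fastforce simp: finite_support_def)
  show "combination u (\<lambda>i. if i = j then s else 0) = s *\<^sub>R u j"
    using combination_eq_sum[OF _ A] by simp
qed

text \<open>This equality is the only Hilbert space property that the smoothness of the norm below rests on.\<close>

lemma ell2_parallelogram:
  assumes "c \<in> finite_support"
  shows "(ell2 (\<lambda>i. c i + (if i = j then s else 0)))\<^sup>2
       + (ell2 (\<lambda>i. c i + (if i = j then - s else 0)))\<^sup>2 = 2 * (ell2 c)\<^sup>2 + 2 * s\<^sup>2"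
proof -
  define A where "A = insert j {i. c i \<noteq> 0}"
  have A: "finite A" "{i. c i \<noteq> 0} \<subseteq> A" "{i. c i + (if i = j then s else 0) \<noteq> 0} \<subseteq> A"
    "{i. c i + (if i = j then - s else 0) \<noteq> 0} \<subseteq> A" "j \<in> A"
    using assms by (auto simp: A_def finite_support_def)
  have "(\<Sum>i\<in>A. (c i + (if i = j then s else 0))\<^sup>2) + (\<Sum>i\<in>A. (c i + (if i = j then - s else 0))\<^sup>2)
     = (\<Sum>i\<in>A. 2 * (c i)\<^sup>2 + (if i = j then 2 * s\<^sup>2 else 0))"
    unfolding sum.distrib[symmetric] by (intro sum.cong) (auto simp: power2_eq_square algebra_simps)
  also have "\<dots> = 2 * (\<Sum>i\<in>A. (c i)\<^sup>2) + 2 * s\<^sup>2"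
    using A by (simp add: sum.distrib sum_distrib_left[symmetric])
  finally show ?thesis
    using A by (simp add: ell2_eq_L2_set[of A] L2_set_def sum_nonneg)
qed

lemma ell2_nonneg: "0 \<le> ell2 c"
  by (simp add: ell2_def L2_set_nonneg)

text \<open>Cauchy--Schwarz against the sequence \<open>norm (u i)\<close>, whose \<open>\<ell>\<^sub>2\<close> norm is at most \<open>\<Sum>i. (1/2) ^ Suc i = 1\<close>.\<close>

lemma norm_combination_le_ell2:
  fixes u :: "nat \<Rightarrow> 'a::real_normed_vector"
  assumes "\<And>i. norm (u i) \<le> (1/2) ^ Suc i"
  shows "norm (combination u c) \<le> ell2 c"
proof (cases "finite {i. c i \<noteq> 0}")
  case True
  let ?A = "{i. c i \<noteq> 0}"
  have "L2_set (\<lambda>i. norm (u i)) ?A \<le> (\<Sum>i\<in>?A. norm (u i))"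
    by (rule L2_set_le_sum) auto
  also have "\<dots> \<le> (\<Sum>i\<in>?A. (1/2) ^ Suc i)"
    by (intro sum_mono assms)
  also have "\<dots> \<le> (\<Sum>i. (1/2::real) ^ Suc i)"
    using True power_half_series by (intro sum_le_suminf) (auto simp: sums_iff)
  also have "\<dots> = 1"
    using power_half_series by (simp add: sums_iff)
  finally have le1: "L2_set (\<lambda>i. norm (u i)) ?A \<le> 1" .
  have "norm (combination u c) \<le> (\<Sum>i\<in>?A. \<bar>c i\<bar> * \<bar>norm (u i)\<bar>)"
    unfolding combination_def by (rule order_trans[OF norm_sum]) simp
  also have "\<dots> \<le> L2_set c ?A * L2_set (\<lambda>i. norm (u i)) ?A"
    by (rule L2_set_mult_ineq)
  also have "\<dots> \<le> ell2 c * 1"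
    unfolding ell2_def by (intro mult_left_mono le1 L2_set_nonneg)
  finally show ?thesis by simp
next
  case False
  then show ?thesis by (simp add: combination_def ell2_nonneg)
qed

text \<open>The norm of a pair is \<open>sqrt ((norm (x - K c))\<^sup>2 + (ell2 c)\<^sup>2)\<close> with \<open>K = combination u\<close>, so this is the
quotient norm on the space of pairs \<open>(x, c)\<close> modulo the pairs \<open>(K c, - c)\<close>: the given norm, smoothed by the
Hilbert norm in the directions \<open>u i\<close>.\<close>

definition smoothed_norm :: "(nat \<Rightarrow> 'a::real_normed_vector) \<Rightarrow> 'a \<Rightarrow> real"
  where "smoothed_norm u x = (INF c\<in>finite_support. norm (x - combination u c, ell2 c))"

lemma smoothed_norm_le:
  assumes "c \<in> finite_support"
  shows "smoothed_norm u x \<le> norm (x - combination u c, ell2 c)"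
  unfolding smoothed_norm_def using assms
  by (intro cINF_lower bdd_belowI[of _ 0]) auto

lemma smoothed_norm_greatest:
  assumes "\<And>c. c \<in> finite_support \<Longrightarrow> a \<le> norm (x - combination u c, ell2 c)"
  shows "a \<le> smoothed_norm u x"
  unfolding smoothed_norm_def using assms finite_support_single(1) by (intro cINF_greatest) auto

lemma smoothed_norm_bounds:
  assumes u: "\<And>i. norm (u i) \<le> (1/2) ^ Suc i"
  shows "norm x / 2 \<le> smoothed_norm u x" and "smoothed_norm u x \<le> norm x"
proof -
  have "(\<lambda>_. 0) \<in> finite_support" "combination u (\<lambda>_. 0) = 0" "ell2 (\<lambda>_. 0) = 0"
    by (auto simp: finite_support_def combination_def ell2_def)
  then show "smoothed_norm u x \<le> norm x"
    using smoothed_norm_le[of "\<lambda>_. 0" u x] by simp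
  show "norm x / 2 \<le> smoothed_norm u x"
  proof (rule smoothed_norm_greatest)
    fix c assume c: "c \<in> finite_support"
    have "norm x \<le> norm (x - combination u c) + norm (combination u c)"
      using norm_triangle_ineq[of "x - combination u c" "combination u c"] by simp
    also have "\<dots> \<le> norm (x - combination u c) + ell2 c"
      using norm_combination_le_ell2[OF u] by simp
    also have "\<dots> \<le> 2 * norm (x - combination u c, ell2 c)"
      using norm_fst_le[of "(x - combination u c)" "ell2 c"] norm_snd_le[of "ell2 c" "(x - combination u c)"]
      by simp
    finally show "norm x / 2 \<le> norm (x - combination u c, ell2 c)" by simp
  qed
qed

lemma smoothed_norm_triangle: "smoothed_norm u (x + y) \<le> smoothed_norm u x + smoothed_norm u y"
proof -
  have *: "smoothed_norm u (x + y) \<le> norm (x - combination u c, ell2 c) + norm (y - combination u d, ell2 d)"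
    if c: "c \<in> finite_support" and d: "d \<in> finite_support" for c d
  proof -
    let ?e = "\<lambda>i. c i + d i"
    have "smoothed_norm u (x + y) \<le> norm (x + y - combination u ?e, ell2 ?e)"
      using finite_support_add(1)[OF c d] by (rule smoothed_norm_le)
    also have "\<dots> \<le> norm (x + y - combination u ?e, ell2 c + ell2 d)"
      using finite_support_add(3)[OF c d] by (auto simp: norm_Pair ell2_nonneg intro!: power_mono)
    also have "\<dots> = norm ((x - combination u c, ell2 c) + (y - combination u d, ell2 d))"
      by (simp add: finite_support_add(2)[OF c d] algebra_simps)
    also have "\<dots> \<le> norm (x - combination u c, ell2 c) + norm (y - combination u d, ell2 d)"
      by (rule norm_triangle_ineq)
    finally show ?thesis .
  qed
  have "smoothed_norm u (x + y) - norm (y - combination u d, ell2 d) \<le> smoothed_norm u x"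
    if "d \<in> finite_support" for d
    using *[OF _ that] by (intro smoothed_norm_greatest) (simp add: algebra_simps)
  then have "smoothed_norm u (x + y) - smoothed_norm u x \<le> smoothed_norm u y"
    by (intro smoothed_norm_greatest) (simp add: algebra_simps)
  then show ?thesis by simp
qed

lemma smoothed_norm_scale_le: "smoothed_norm u (s *\<^sub>R x) \<le> \<bar>s\<bar> * smoothed_norm u x" if "s \<noteq> 0"
proof -
  have "smoothed_norm u (s *\<^sub>R x) / \<bar>s\<bar> \<le> smoothed_norm u x"
  proof (rule smoothed_norm_greatest)
    fix c assume c: "c \<in> finite_support"
    have "smoothed_norm u (s *\<^sub>R x) \<le> norm (s *\<^sub>R x - s *\<^sub>R combination u c, \<bar>s\<bar> * ell2 c)"
      using smoothed_norm_le[OF finite_support_scale(1)[OF c, of s], of u "s *\<^sub>R x"]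
      by (simp add: finite_support_scale[OF c])
    also have "\<dots> = \<bar>s\<bar> * norm (x - combination u c, ell2 c)"
      by (simp add: norm_Pair scaleR_diff_right[symmetric] power_mult_distrib
          distrib_left[symmetric] real_sqrt_mult)
    finally show "smoothed_norm u (s *\<^sub>R x) / \<bar>s\<bar> \<le> norm (x - combination u c, ell2 c)"
      using that by (simp add: divide_simps mult.commute)
  qed
  then show ?thesis using that by (simp add: divide_simps mult.commute)
qed

lemma norm_on_smoothed_norm:
  assumes u: "\<And>i. norm (u i) \<le> (1/2) ^ Suc i"
  shows "norm_on (smoothed_norm u)"
  unfolding norm_on_def
proof (intro conjI allI)
  note b = smoothed_norm_bounds[of u, OF u]
  show "0 \<le> smoothed_norm u x" for x
    using b(1)[of x] norm_ge_zero[of x] by linarith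
  have z: "smoothed_norm u 0 = 0"
    using b[of 0] by simp
  show "(smoothed_norm u x = 0) = (x = 0)" for x
    using b(1)[of x] z by auto
  show "smoothed_norm u (x + y) \<le> smoothed_norm u x + smoothed_norm u y" for x y
    by (rule smoothed_norm_triangle)
  show "smoothed_norm u (s *\<^sub>R x) = \<bar>s\<bar> * smoothed_norm u x" for s x
  proof (cases "s = 0")
    case False
    have "smoothed_norm u x \<le> \<bar>inverse s\<bar> * smoothed_norm u (s *\<^sub>R x)"
      using smoothed_norm_scale_le[of "inverse s" u "s *\<^sub>R x"] False by simp
    then have "\<bar>s\<bar> * smoothed_norm u x \<le> smoothed_norm u (s *\<^sub>R x)"
      using False by (simp add: field_simps)
    then show ?thesis
      using smoothed_norm_scale_le[OF False, of u x] by simp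
  qed (simp add: z)
qed

text \<open>A step along \<open>u j\<close> can be charged entirely to the coefficient of \<open>u j\<close>, that is, to the Hilbert part of the
infimum, where the parallelogram law holds; the part \<open>x - combination u c\<close> does not move.\<close>

lemma smoothed_norm_parallelogram:
  "(smoothed_norm u (x + s *\<^sub>R u j))\<^sup>2 + (smoothed_norm u (x - s *\<^sub>R u j))\<^sup>2
     \<le> 2 * (smoothed_norm u x)\<^sup>2 + 2 * s\<^sup>2" (is "?L \<le> _")
proof -
  have nn: "0 \<le> smoothed_norm u z" for z
    by (rule smoothed_norm_greatest) simp
  have "sqrt (?L / 2 - s\<^sup>2) \<le> smoothed_norm u x"
  proof (rule smoothed_norm_greatest)
    fix c assume c: "c \<in> finite_support"
    define d where "d = (\<lambda>s i. c i + (if i = j then s else (0::real)))"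
    have d: "d s \<in> finite_support" "combination u (d s) = combination u c + s *\<^sub>R u j" for s
      unfolding d_def finite_support_single(2)[symmetric]
      by (rule finite_support_add[OF c finite_support_single(1)])+
    have 1: "(smoothed_norm u (x + s *\<^sub>R u j))\<^sup>2 \<le> (norm (x - combination u c))\<^sup>2 + (ell2 (d s))\<^sup>2" for s
    proof -
      have "smoothed_norm u (x + s *\<^sub>R u j) \<le> norm (x - combination u c, ell2 (d s))"
        using smoothed_norm_le[OF d(1)[of s], of u "x + s *\<^sub>R u j"] by (simp add: d(2))
      from power_mono[OF this nn, of 2] show ?thesis by (simp add: norm_Pair)
    qed
    have "?L \<le> 2 * (norm (x - combination u c))\<^sup>2 + ((ell2 (d s))\<^sup>2 + (ell2 (d (- s)))\<^sup>2)"
      using 1[of s] 1[of "- s"] by simp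
    also have "(ell2 (d s))\<^sup>2 + (ell2 (d (- s)))\<^sup>2 = 2 * (ell2 c)\<^sup>2 + 2 * s\<^sup>2"
      unfolding d_def by (rule ell2_parallelogram[OF c])
    finally have "?L \<le> 2 * (norm (x - combination u c, ell2 c))\<^sup>2 + 2 * s\<^sup>2"
      by (simp add: norm_Pair)
    then have "?L / 2 - s\<^sup>2 \<le> (norm (x - combination u c, ell2 c))\<^sup>2"
      by argo
    then have "sqrt (?L / 2 - s\<^sup>2) \<le> sqrt ((norm (x - combination u c, ell2 c))\<^sup>2)"
      by (rule real_sqrt_le_mono)
    then show "sqrt (?L / 2 - s\<^sup>2) \<le> norm (x - combination u c, ell2 c)"
      by simp
  qed
  from sqrt_le_D[OF this] show ?thesis by argo
qed

lemma second_difference_nonneg: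
  assumes "norm_on N" "t > 0"
  shows "0 \<le> second_difference N x v t"
proof -
  have "2 * N x = N ((x + t *\<^sub>R v) + (x - t *\<^sub>R v))"
    using assms(1) unfolding norm_on_def by (metis abs_numeral scaleR_2 add.commute add_diff_cancel_left' diff_add_eq add_diff_eq)
  also have "\<dots> \<le> N (x + t *\<^sub>R v) + N (x - t *\<^sub>R v)"
    using assms(1) unfolding norm_on_def by blast
  finally show ?thesis using assms(2) by (simp add: second_difference_def)
qed

text \<open>Along a multiple \<open>s *\<^sub>R u j\<close> the parallelogram estimate bounds the second difference by \<open>O(t)\<close>. A general
direction \<open>v\<close> differs from some \<open>s *\<^sub>R u j\<close> by a vector of norm at most \<open>\<epsilon>\<close>, which changes the second
difference by at most a multiple of \<open>\<epsilon>\<close>.\<close>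

lemma second_difference_smoothed_norm:
  assumes u: "\<And>i. norm (u i) \<le> (1/2) ^ Suc i"
    and dense: "closure (\<Union>s. range (\<lambda>j. s *\<^sub>R u j)) = UNIV"
    and x: "x \<noteq> 0"
  shows "(second_difference (smoothed_norm u) x v \<longlongrightarrow> 0) (at_right 0)"
proof (rule tendstoI)
  fix \<epsilon> :: real assume "\<epsilon> > 0"
  let ?q = "smoothed_norm u"
  note q = norm_on_smoothed_norm[of u, OF u]
  have pos: "?q x > 0"
    using q x unfolding norm_on_def by (metis less_eq_real_def)
  obtain s j where sj: "norm (v - s *\<^sub>R u j) < \<epsilon> / 4"
  proof -
    have "v \<in> closure (\<Union>s. range (\<lambda>j. s *\<^sub>R u j))" by (simp add: dense)
    then obtain y where y: "y \<in> (\<Union>s. range (\<lambda>j. s *\<^sub>R u j))" "dist y v < \<epsilon> / 4"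
      using \<open>\<epsilon> > 0\<close> unfolding closure_approachable by (metis divide_pos_pos zero_less_numeral)
    then show ?thesis
      using that by (auto simp: dist_norm norm_minus_commute)
  qed
  have bound: "second_difference ?q x v t \<le> t * s\<^sup>2 / ?q x + \<epsilon> / 2" if t: "t > 0" for t
  proof -
    let ?w = "s *\<^sub>R u j"
    have *: "?q (y + r *\<^sub>R v) \<le> ?q (y + r *\<^sub>R ?w) + \<bar>r\<bar> * (\<epsilon> / 4)" for y r
    proof -
      have "?q (y + r *\<^sub>R v) = ?q ((y + r *\<^sub>R ?w) + r *\<^sub>R (v - ?w))"
        by (simp add: algebra_simps)
      also have "\<dots> \<le> ?q (y + r *\<^sub>R ?w) + ?q (r *\<^sub>R (v - ?w))"
        by (rule smoothed_norm_triangle)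
      also have "?q (r *\<^sub>R (v - ?w)) \<le> norm (r *\<^sub>R (v - ?w))"
        by (rule smoothed_norm_bounds(2)[OF u])
      also have "\<dots> \<le> \<bar>r\<bar> * (\<epsilon> / 4)"
        using mult_left_mono[OF less_imp_le[OF sj], of "\<bar>r\<bar>"] by simp
      finally show ?thesis by simp
    qed
    define a b where "a = ?q (x + t *\<^sub>R ?w)" and "b = ?q (x - t *\<^sub>R ?w)"
    have nn: "a \<ge> 0" "b \<ge> 0" using q unfolding a_def b_def norm_on_def by blast+
    have "a\<^sup>2 + b\<^sup>2 \<le> 2 * (?q x)\<^sup>2 + 2 * (t * s)\<^sup>2"
      using smoothed_norm_parallelogram[of u x "t * s" j] by (simp add: a_def b_def)
    moreover have "(a + b)\<^sup>2 \<le> 2 * (a\<^sup>2 + b\<^sup>2)"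
      using zero_le_power2[of "a - b"] by (simp add: power2_eq_square algebra_simps)
    ultimately have "(a + b)\<^sup>2 \<le> 4 * (?q x)\<^sup>2 + 4 * (t * s)\<^sup>2" by simp
    also have "\<dots> \<le> (2 * ?q x + (t * s)\<^sup>2 / ?q x)\<^sup>2"
      using pos by (simp add: power2_sum power_mult_distrib)
    finally have "a + b \<le> 2 * ?q x + (t * s)\<^sup>2 / ?q x"
      using pos by (auto intro: power2_le_imp_le)
    moreover have "?q (x + t *\<^sub>R v) \<le> a + t * (\<epsilon> / 4)" "?q (x - t *\<^sub>R v) \<le> b + t * (\<epsilon> / 4)"
      using *[of x t] *[of x "- t"] t by (simp_all add: a_def b_def)
    ultimately have "?q (x + t *\<^sub>R v) + ?q (x - t *\<^sub>R v) - 2 * ?q x \<le> (t * s\<^sup>2 / ?q x + \<epsilon> / 2) * t"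
      by (simp add: field_simps power2_eq_square)
    then show ?thesis
      using t by (simp add: second_difference_def divide_le_eq)
  qed
  have "((\<lambda>t. t * s\<^sup>2 / ?q x + \<epsilon> / 2) \<longlongrightarrow> 0 * s\<^sup>2 / ?q x + \<epsilon> / 2) (at_right 0)"
    using pos by (intro tendsto_intros) auto
  then have "\<forall>\<^sub>F t in at_right 0. t * s\<^sup>2 / ?q x + \<epsilon> / 2 < \<epsilon>"
    using \<open>\<epsilon> > 0\<close> by (intro order_tendstoD(2)[where y = "0 * s\<^sup>2 / ?q x + \<epsilon> / 2"]) auto
  then show "\<forall>\<^sub>F t in at_right 0. dist (second_difference ?q x v t) 0 < \<epsilon>"
    using eventually_at_right_less[of "0::real"]
  proof eventually_elim
    case (elim t)
    then show ?case
      using bound[of t] second_difference_nonneg[OF q, of t x v] by simp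
  qed
qed

theorem smooth_equivalent_norm:
  assumes "separable_space (euclidean :: 'a::real_normed_vector topology)"
  obtains q :: "'a::real_normed_vector \<Rightarrow> real"
  where "norm_on q" "\<And>x. norm x / 2 \<le> q x" "\<And>x. q x \<le> norm x"
    "\<And>x v. x \<noteq> 0 \<Longrightarrow> (second_difference q x v \<longlongrightarrow> 0) (at_right 0)"
proof -
  obtain C :: "'a set" where C: "countable C" "closure C = UNIV"
    using assms unfolding separable_space_def by (metis euclidean_closure_of topspace_euclidean)
  then have "C \<noteq> {}" by auto
  define d where "d = from_nat_into C"
  have d: "range d = C"
    unfolding d_def using C \<open>C \<noteq> {}\<close> range_from_nat_into by auto
  define u where "u = (\<lambda>i. ((1/2) ^ Suc i / (1 + norm (d i))) *\<^sub>R d i)"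
  have u: "norm (u i) \<le> (1/2) ^ Suc i" for i
  proof -
    have "norm (d i) / (1 + norm (d i)) \<le> 1" by (auto simp: divide_le_eq_1 add_pos_nonneg)
    then have "(1/2) ^ Suc i * (norm (d i) / (1 + norm (d i))) \<le> (1/2) ^ Suc i * 1"
      by (intro mult_left_mono) auto
    then show ?thesis by (simp add: u_def)
  qed
  have "d i = inverse ((1/2) ^ Suc i / (1 + norm (d i))) *\<^sub>R u i" for i
  proof -
    have "(1/2) ^ Suc i / (1 + norm (d i)) \<noteq> 0" using add_pos_nonneg[OF zero_less_one norm_ge_zero[of "d i"]] by simp
    from left_inverse[OF this] show ?thesis by (simp add: u_def del: inverse_divide)
  qed
  then have "C \<subseteq> (\<Union>s. range (\<lambda>j. s *\<^sub>R u j))"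
    unfolding d[symmetric] by blast
  then have "closure (\<Union>s. range (\<lambda>j. s *\<^sub>R u j)) = UNIV"
    using C(2) closure_mono by blast
  then show ?thesis
    using that[of "smoothed_norm u"] norm_on_smoothed_norm smoothed_norm_bounds
      second_difference_smoothed_norm u by blast
qed

section \<open>Supporting functionals as derivatives of the smooth norm\<close>

text \<open>For a convex function the difference quotients increase with the step, so their infimum is the one-sided
derivative.\<close>

definition directional_derivative :: "('a::real_vector \<Rightarrow> real) \<Rightarrow> 'a \<Rightarrow> 'a \<Rightarrow> real"
  where "directional_derivative N x v = (INF t\<in>{0<..}. (N (x + t *\<^sub>R v) - N x) / t)"

lemma difference_quotient_mono:
  assumes N: "norm_on N" and st: "0 < s" "s \<le> t"
  shows "(N (x + s *\<^sub>R v) - N x) / s \<le> (N (x + t *\<^sub>R v) - N x) / t"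
proof -
  have "x + s *\<^sub>R v = (1 - s / t) *\<^sub>R x + (s / t) *\<^sub>R (x + t *\<^sub>R v)"
    using st by (simp add: algebra_simps)
  then have "N (x + s *\<^sub>R v) \<le> N ((1 - s / t) *\<^sub>R x) + N ((s / t) *\<^sub>R (x + t *\<^sub>R v))"
    using N unfolding norm_on_def by metis
  also have "\<dots> = (1 - s / t) * N x + (s / t) * N (x + t *\<^sub>R v)"
    using N st unfolding norm_on_def by simp
  finally have "N (x + s *\<^sub>R v) - N x \<le> s * ((N (x + t *\<^sub>R v) - N x) / t)"
    by (simp add: algebra_simps diff_divide_distrib)
  then show ?thesis using st by (simp add: divide_le_eq mult.commute)
qed

lemma difference_quotient_ge:
  assumes N: "norm_on N" and t: "0 < t"
  shows "- N v \<le> (N (x + t *\<^sub>R v) - N x) / t"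
proof -
  have "N x = N ((x + t *\<^sub>R v) + (- t) *\<^sub>R v)" by simp
  also have "\<dots> \<le> N (x + t *\<^sub>R v) + N ((- t) *\<^sub>R v)"
    using N unfolding norm_on_def by blast
  also have "N ((- t) *\<^sub>R v) = t * N v"
    using N t unfolding norm_on_def by (metis abs_minus_cancel abs_of_pos)
  finally show ?thesis using t by (simp add: le_divide_eq algebra_simps)
qed

lemma directional_derivative_le:
  assumes "norm_on N" "0 < t"
  shows "directional_derivative N x v \<le> (N (x + t *\<^sub>R v) - N x) / t"
  unfolding directional_derivative_def using assms difference_quotient_ge
  by (intro cINF_lower bdd_belowI[of _ "- N v"]) auto

lemma directional_derivative_greatest:
  assumes "\<And>t. 0 < t \<Longrightarrow> a \<le> (N (x + t *\<^sub>R v) - N x) / t"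
  shows "a \<le> directional_derivative N x v"
  unfolding directional_derivative_def using assms by (intro cINF_greatest) auto

text \<open>Convexity at the midpoint of \<open>x + 2 r v\<close> and \<open>x + 2 r w\<close>, where \<open>2 r\<close> is at most both given
step sizes.\<close>

lemma directional_derivative_add_le:
  assumes N: "norm_on N"
  shows "directional_derivative N x (v + w) \<le> directional_derivative N x v + directional_derivative N x w"
proof -
  have *: "directional_derivative N x (v + w) \<le> (N (x + s *\<^sub>R v) - N x) / s + (N (x + t *\<^sub>R w) - N x) / t"
    if st: "0 < s" "0 < t" for s t
  proof -
    define r where "r = min s t / 2"
    have r: "0 < r" "2 * r \<le> s" "2 * r \<le> t" using st by (auto simp: r_def)
    have half: "a / (2 * r) * r = a / 2" for a using r(1) by simp
    have "x + r *\<^sub>R (v + w) = (1/2) *\<^sub>R (x + (2 * r) *\<^sub>R v) + (1/2) *\<^sub>R (x + (2 * r) *\<^sub>R w)"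
      by (simp add: algebra_simps flip: scaleR_add_left)
    then have "N (x + r *\<^sub>R (v + w)) \<le> N ((1/2) *\<^sub>R (x + (2 * r) *\<^sub>R v)) + N ((1/2) *\<^sub>R (x + (2 * r) *\<^sub>R w))"
      using N unfolding norm_on_def by metis
    also have "\<dots> = (N (x + (2 * r) *\<^sub>R v) + N (x + (2 * r) *\<^sub>R w)) / 2"
      using N unfolding norm_on_def by simp
    finally have "N (x + r *\<^sub>R (v + w)) - N x
        \<le> ((N (x + (2 * r) *\<^sub>R v) - N x) / (2 * r) + (N (x + (2 * r) *\<^sub>R w) - N x) / (2 * r)) * r"
      unfolding distrib_right half by argo
    then have "(N (x + r *\<^sub>R (v + w)) - N x) / r
        \<le> (N (x + (2 * r) *\<^sub>R v) - N x) / (2 * r) + (N (x + (2 * r) *\<^sub>R w) - N x) / (2 * r)"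
      using r(1) by (simp only: divide_le_eq if_True)
    also have "\<dots> \<le> (N (x + s *\<^sub>R v) - N x) / s + (N (x + t *\<^sub>R w) - N x) / t"
      using r by (intro add_mono difference_quotient_mono N) auto
    finally show ?thesis
      using directional_derivative_le[OF N r(1), of x "v + w"] by linarith
  qed
  have "directional_derivative N x (v + w) - (N (x + t *\<^sub>R w) - N x) / t \<le> directional_derivative N x v"
    if "0 < t" for t
    using *[OF _ that] by (intro directional_derivative_greatest) (simp add: algebra_simps)
  then have "directional_derivative N x (v + w) - directional_derivative N x v \<le> directional_derivative N x w"
    by (intro directional_derivative_greatest) (simp add: algebra_simps)
  then show ?thesis by simp
qed

text \<open>Smoothness says that the one-sided derivatives in the directions \<open>v\<close> and \<open>-v\<close> cancel. Together with
subadditivity this makes the directional derivative linear.\<close>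

lemma directional_derivative_uminus:
  assumes N: "norm_on N"
    and smooth: "(second_difference N x v \<longlongrightarrow> 0) (at_right 0)"
  shows "directional_derivative N x (- v) = - directional_derivative N x v"
proof (rule antisym)
  have "directional_derivative N x v + directional_derivative N x (- v) \<le> second_difference N x v t"
    if t: "t > 0" for t
    using directional_derivative_le[OF N t, of x v] directional_derivative_le[OF N t, of x "- v"]
    by (simp add: second_difference_def diff_divide_distrib add_divide_distrib)
  then have "\<forall>\<^sub>F t in at_right 0. directional_derivative N x v + directional_derivative N x (- v)
     \<le> second_difference N x v t"
    using eventually_at_right_less[of "0::real"] by (auto elim: eventually_mono)
  then have "directional_derivative N x v + directional_derivative N x (- v) \<le> 0"
    using smooth by (intro tendsto_lowerbound) auto
  then show "directional_derivative N x (- v) \<le> - directional_derivative N x v" by simp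
next
  have "0 \<le> directional_derivative N x 0"
    by (rule directional_derivative_greatest) simp
  then show "- directional_derivative N x v \<le> directional_derivative N x (- v)"
    using directional_derivative_add_le[OF N, of x v "- v"] by simp
qed

lemma directional_derivative_scaleR_pos:
  assumes N: "norm_on N" and s: "0 < s"
  shows "directional_derivative N x (s *\<^sub>R v) = s * directional_derivative N x v"
proof -
  have le: "directional_derivative N x (s *\<^sub>R v) \<le> s * directional_derivative N x v" if s: "0 < s" for s v
  proof -
    have "directional_derivative N x (s *\<^sub>R v) / s \<le> directional_derivative N x v"
    proof (rule directional_derivative_greatest)
      fix t :: real assume t: "0 < t"
      then show "directional_derivative N x (s *\<^sub>R v) / s \<le> (N (x + t *\<^sub>R v) - N x) / t"
        using directional_derivative_le[OF N, of "t / s" x "s *\<^sub>R v"] s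
        by (simp add: field_simps)
    qed
    then show ?thesis using s by (simp add: field_simps)
  qed
  have "directional_derivative N x v \<le> inverse s * directional_derivative N x (s *\<^sub>R v)"
    using le[of "inverse s" "s *\<^sub>R v"] s by simp
  then show ?thesis using le[OF s, of v] s by (simp add: field_simps)
qed

text \<open>The derivative of a smooth norm at \<open>x\<close> is a functional of norm at most \<open>1\<close>. Its value at \<open>x\<close> is \<open>q x\<close>
because \<open>q\<close> is linear along the ray through \<open>x\<close>.\<close>

lemma supporting_functional:
  fixes q :: "'a::real_normed_vector \<Rightarrow> real"
  assumes q: "norm_on q" and le: "\<And>x. q x \<le> norm x"
    and smooth: "\<And>v. (second_difference q x v \<longlongrightarrow> 0) (at_right 0)"
  obtains f :: "'a \<Rightarrow>\<^sub>L real" where "f x = q x" "\<And>v. \<bar>f v\<bar> \<le> norm v"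
proof -
  define D where "D = directional_derivative q x"
  note minus = directional_derivative_uminus[OF q smooth, folded D_def]
  note add_le = directional_derivative_add_le[OF q, of x, folded D_def]
  have add: "D (v + w) = D v + D w" for v w
    using add_le[of v w] add_le[of "- v" "- w"] minus[of v] minus[of w] minus[of "v + w"] by simp
  have le_norm: "D v \<le> norm v" for v
  proof -
    have "D v \<le> q (x + v) - q x"
      using directional_derivative_le[OF q, of 1 x v] by (simp add: D_def)
    also have "\<dots> \<le> q v"
      using q unfolding norm_on_def by (simp add: algebra_simps)
    finally show ?thesis using le[of v] by simp
  qed
  have bound: "\<bar>D v\<bar> \<le> norm v" for v
    using le_norm[of v] le_norm[of "- v"] minus[of v] by simp
  have scale: "D (s *\<^sub>R v) = s * D v" for s v
  proof -
    have "D 0 = 0" using minus[of 0] by simp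
    moreover have "D (s *\<^sub>R v) = s * D v" if "s < 0"
      using directional_derivative_scaleR_pos[OF q, of "- s" x v] that minus[of "s *\<^sub>R v"]
      by (simp add: D_def)
    ultimately show ?thesis
      using directional_derivative_scaleR_pos[OF q, of s x v]
      by (cases s "0::real" rule: linorder_cases) (auto simp: D_def)
  qed
  have "bounded_linear D"
    using add scale bound by (intro bounded_linear_intro[where K = 1]) auto
  then have D: "blinfun_apply (Blinfun D) = D" by (rule bounded_linear_Blinfun_apply)
  have "(q (x + t *\<^sub>R x) - q x) / t = q x" if t: "0 < t" for t
  proof -
    have "q (x + t *\<^sub>R x) = q ((1 + t) *\<^sub>R x)" by (simp add: algebra_simps)
    also have "\<dots> = (1 + t) * q x" using q t unfolding norm_on_def by simp
    finally show ?thesis using t by (simp add: algebra_simps)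
  qed
  then have "D x = (INF t\<in>{0::real<..}. q x)"
    unfolding D_def directional_derivative_def by (intro INF_cong) auto
  then have "D x = q x" by simp
  then show ?thesis using that[of "Blinfun D"] D bound by simp
qed

theorem separable_hahn_banach:
  fixes x :: "'a::real_normed_vector"
  assumes "separable_space (euclidean :: 'a topology)"
  obtains f :: "'a \<Rightarrow>\<^sub>L real" where "norm x / 2 \<le> f x" "\<And>v. \<bar>f v\<bar> \<le> norm v"
proof (cases "x = 0")
  case True
  then show ?thesis using that[of 0] by simp
next
  case False
  obtain q :: "'a \<Rightarrow> real" where q: "norm_on q" "\<And>x. norm x / 2 \<le> q x" "\<And>x. q x \<le> norm x"
    "\<And>x v. x \<noteq> 0 \<Longrightarrow> (second_difference q x v \<longlongrightarrow> 0) (at_right 0)"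
    using smooth_equivalent_norm[OF assms] by blast
  obtain f :: "'a \<Rightarrow>\<^sub>L real" where "f x = q x" "\<And>v. \<bar>f v\<bar> \<le> norm v"
    using supporting_functional[OF q(1,3,4)] False by blast
  then show ?thesis using that[of f] q(2)[of x] by simp
qed

text \<open>Supporting functionals at the points of a countable dense set suffice: if \<open>x \<noteq> 0\<close>, the functional that
supports a point close enough to \<open>x\<close> cannot vanish at \<open>x\<close>.\<close>

lemma countable_separating_functionals:
  assumes sep: "separable_space (euclidean :: 'a::real_normed_vector topology)"
  obtains \<eta> :: "nat \<Rightarrow> 'a::real_normed_vector \<Rightarrow>\<^sub>L real" where "\<And>x. (\<And>n. \<eta> n x = 0) \<Longrightarrow> x = 0"
proof -
  obtain C :: "'a set" where C: "countable C" "closure C = UNIV"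
    using sep unfolding separable_space_def by (metis euclidean_closure_of topspace_euclidean)
  then have "C \<noteq> {}" by auto
  have "\<forall>x::'a. \<exists>f::'a \<Rightarrow>\<^sub>L real. norm x / 2 \<le> f x \<and> (\<forall>v. \<bar>f v\<bar> \<le> norm v)"
    using separable_hahn_banach[OF sep] by metis
  then obtain F :: "'a \<Rightarrow> 'a \<Rightarrow>\<^sub>L real" where F: "\<And>x. norm x / 2 \<le> F x x" "\<And>x v. \<bar>F x v\<bar> \<le> norm v"
    by metis
  have "x = 0" if x: "\<And>n. F (from_nat_into C n) x = 0" for x
  proof (rule ccontr)
    assume "x \<noteq> 0"
    then obtain y where y: "y \<in> C" "dist y x < norm x / 3"
      using C(2) unfolding closure_approachable[symmetric] 
      by (metis UNIV_I closure_approachable divide_pos_pos zero_less_norm_iff zero_less_numeral)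
    obtain n where n: "y = from_nat_into C n"
      using y(1) C(1) by (metis from_nat_into_surj)
    have "norm y / 2 \<le> F y (y - x)"
      using F(1)[of y] x[of n] n by (simp add: blinfun.diff_right)
    also have "\<dots> \<le> norm (y - x)" using F(2)[of y "y - x"] by simp
    finally have "norm y \<le> 2 * norm (y - x)" by simp
    moreover have "norm x \<le> norm y + norm (y - x)"
      using norm_triangle_ineq3[of x y] norm_minus_commute[of x y] by linarith
    ultimately show False using y(2) \<open>x \<noteq> 0\<close> by (simp add: dist_norm)
  qed
  then show ?thesis using that[of "\<lambda>n. F (from_nat_into C n)"] by blast
qed

section \<open>Points outside countably many hyperplanes\<close>

text \<open>Each kernel meets \<open>S\<close> in a proper closed subspace, which is nowhere dense in \<open>S\<close>; by the Baire category
theorem countably many of them do not cover \<open>S\<close>. This is applied to hyperplanes, to find points that lie on no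
other hyperplane of a countable family, and to the whole dual space.\<close>

lemma avoid_countably_many_kernels:
  fixes S :: "'a::banach set" and L :: "('a \<Rightarrow> real) set"
  assumes S: "closed S" "subspace S" and L: "countable L"
    and bl: "\<And>f. f \<in> L \<Longrightarrow> bounded_linear f"
    and nz: "\<And>f. f \<in> L \<Longrightarrow> \<exists>x\<in>S. f x \<noteq> 0"
  obtains x where "x \<in> S" "\<And>f. f \<in> L \<Longrightarrow> f x \<noteq> 0"
proof -
  define X where "X = subtopology euclidean S"
  define K where "K f = {x\<in>S. f x = 0}" for f :: "'a \<Rightarrow> real"
  have "X interior_of \<Union>(K ` L) = {}"
  proof (rule Baire_category_alt)
    show "completely_metrizable_space X \<or> locally_compact_space X \<and> regular_space X"
      unfolding X_def using S(1) completely_metrizable_space_closedin[OF completely_metrizable_space_euclidean]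
      by (metis closed_closedin)
    show "countable (K ` L)" using L by simp
    fix T assume "T \<in> K ` L"
    then obtain f where f: "f \<in> L" and T: "T = K f" by blast
    interpret f: bounded_linear f by (rule bl[OF f])
    have "closed {x. f x = 0}"
      by (intro closed_Collect_eq continuous_intros f.continuous_on) 
    then have "closedin X T"
      unfolding X_def T K_def by (auto simp: closedin_subtopology intro!: exI[of _ "{x. f x = 0}"])
    moreover have "X interior_of T = {}"
    proof (rule ccontr)
      assume "X interior_of T \<noteq> {}"
      then obtain x where "x \<in> X interior_of T" by blast
      then obtain U where U: "open U" "x \<in> S" "x \<in> U" "S \<inter> U \<subseteq> K f"
        unfolding interior_of_def X_def T by (auto simp: openin_subtopology)
      obtain y where y: "y \<in> S" "f y \<noteq> 0" using nz[OF f] by blast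
      have "((\<lambda>t. x + t *\<^sub>R y) \<longlongrightarrow> x + 0 *\<^sub>R y) (at_right (0::real))"
        by (intro tendsto_intros)
      then have "\<forall>\<^sub>F t in at_right 0. x + t *\<^sub>R y \<in> U"
        using U(1,3) by (auto simp: tendsto_def)
      then have "\<exists>t>0. x + t *\<^sub>R y \<in> U"
        using eventually_happens[OF eventually_conj[OF _ eventually_at_right_less[of "0::real"]]] by force
      then obtain t where t: "t > 0" "x + t *\<^sub>R y \<in> U" by blast
      have "x + t *\<^sub>R y \<in> S" using S(2) U(2) y(1) by (simp add: subspace_add subspace_scale)
      then have "f (x + t *\<^sub>R y) = 0" using t U(4) by (auto simp: K_def)
      moreover have "f x = 0" using U by (auto simp: K_def)
      ultimately show False using t y by (simp add: f.add f.scale)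
    qed
    ultimately show "closedin X T \<and> X interior_of T = {}" by blast
  qed
  moreover have "X interior_of S = S"
    using interior_of_topspace[of X] by (simp add: X_def)
  moreover have "S \<noteq> {}" using S(2) subspace_0 by auto
  ultimately have "\<Union>(K ` L) \<noteq> S" by metis
  then obtain x where "x \<in> S" "x \<notin> \<Union>(K ` L)" by (auto simp: K_def)
  then show ?thesis using that[of x] by (auto simp: K_def)
qed

section \<open>Kinks of absolute values of functionals\<close>

lemma second_difference_abs_le:
  fixes f :: "'a::real_normed_vector \<Rightarrow>\<^sub>L real"
  assumes "t > 0"
  shows "0 \<le> second_difference (\<lambda>x. \<bar>f x\<bar>) x v t"
    and "second_difference (\<lambda>x. \<bar>f x\<bar>) x v t \<le> 2 * \<bar>f v\<bar>"
proof -
  have "\<bar>f x + t * f v\<bar> + \<bar>f x - t * f v\<bar> \<le> 2 * \<bar>f x\<bar> + 2 * (t * \<bar>f v\<bar>)"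
    using abs_triangle_ineq[of "f x" "t * f v"] abs_triangle_ineq4[of "f x" "t * f v"] assms
    by (simp add: abs_mult)
  then show "second_difference (\<lambda>x. \<bar>f x\<bar>) x v t \<le> 2 * \<bar>f v\<bar>"
    using assms unfolding second_difference_def
    by (simp add: blinfun.add_right blinfun.diff_right blinfun.scaleR_right divide_le_eq algebra_simps)
  show "0 \<le> second_difference (\<lambda>x. \<bar>f x\<bar>) x v t"
    using assms unfolding second_difference_def
    by (auto simp: blinfun.add_right blinfun.diff_right blinfun.scaleR_right intro!: divide_nonneg_pos)
qed

text \<open>Away from its kernel \<open>\<bar>f\<bar>\<close> is locally linear, so the second difference vanishes for small steps; on the kernel
it is constant in \<open>t\<close>.\<close>

lemma second_difference_abs:
  fixes f :: "'a::real_normed_vector \<Rightarrow>\<^sub>L real"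
  shows "(second_difference (\<lambda>x. \<bar>f x\<bar>) x v \<longlongrightarrow> (if f x = 0 then 2 * \<bar>f v\<bar> else 0)) (at_right 0)"
proof (rule tendsto_eventually)
  have "((\<lambda>t. t * \<bar>f v\<bar>) \<longlongrightarrow> 0 * \<bar>f v\<bar>) (at_right 0)"
    by (intro tendsto_intros)
  then have small: "\<forall>\<^sub>F t in at_right 0. t * \<bar>f v\<bar> < \<bar>f x\<bar>" if "f x \<noteq> 0"
    using that by (intro order_tendstoD(2)) auto
  show "\<forall>\<^sub>F t in at_right 0. second_difference (\<lambda>x. \<bar>f x\<bar>) x v t = (if f x = 0 then 2 * \<bar>f v\<bar> else 0)"
  proof (cases "f x = 0")
    case True
    then show ?thesis
      using eventually_at_right_less[of "0::real"]
      by (auto elim!: eventually_mono simp: second_difference_def blinfun.add_right blinfun.diff_right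
          blinfun.scaleR_right abs_mult)
  next
    case False
    from small[OF False] eventually_at_right_less[of "0::real"] show ?thesis
    proof eventually_elim
      case (elim t)
      then have "\<bar>t * f v\<bar> < \<bar>f x\<bar>" by (simp add: abs_mult)
      then have "\<bar>f x + t * f v\<bar> + \<bar>f x - t * f v\<bar> = 2 * \<bar>f x\<bar>" by arith
      then show ?case
        using False by (simp add: second_difference_def blinfun.add_right blinfun.diff_right
          blinfun.scaleR_right)
    qed
  qed
qed

text \<open>The two alternatives cannot both fail: if \<open>f\<close> and \<open>g\<close> differ at \<open>a\<close> while \<open>f\<close> and \<open>-g\<close> differ at \<open>b\<close>, then the
absolute values disagree at \<open>a\<close>, at \<open>b\<close> or at \<open>a + b\<close>.\<close>

lemma linear_functionals_abs_eq:
  fixes f g :: "'a::real_vector \<Rightarrow> real"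
  assumes "linear f" "linear g" and eq: "\<And>v. \<bar>f v\<bar> = \<bar>g v\<bar>"
  shows "(\<forall>v. f v = g v) \<or> (\<forall>v. f v = - g v)"
proof (rule ccontr)
  assume "\<not> ?thesis"
  then obtain a b where "f a \<noteq> g a" "f b \<noteq> - g b" by blast
  then show False
    using eq[of a] eq[of b] eq[of "a + b"] linear_add[OF assms(1), of a b] linear_add[OF assms(2), of a b]
    by arith
qed

section \<open>Norms summed over a finite group of operators\<close>

definition orbit_sum :: "('a \<Rightarrow> 'a) set \<Rightarrow> ('a \<Rightarrow> real) \<Rightarrow> 'a \<Rightarrow> real"
  where "orbit_sum G M x = (\<Sum>g\<in>G. M (g x))"

locale finite_operator_group =
  fixes G :: "('a::real_normed_vector \<Rightarrow> 'a) set"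
  assumes finite_G: "finite G"
    and bounded_linear_G: "\<And>g. g \<in> G \<Longrightarrow> bounded_linear g"
    and id_G: "(\<lambda>x. x) \<in> G"
    and minus_G: "(\<lambda>x. - x) \<in> G"
    and comp_G: "\<And>g h. g \<in> G \<Longrightarrow> h \<in> G \<Longrightarrow> (\<lambda>x. g (h x)) \<in> G"
    and inverse_G: "\<And>g. g \<in> G \<Longrightarrow> \<exists>h\<in>G. (\<forall>x. h (g x) = x) \<and> (\<forall>x. g (h x) = x)"
begin

lemma linear_G: "g \<in> G \<Longrightarrow> linear g"
  using bounded_linear_G bounded_linear.linear by blast

lemma G_eq_0_iff: "g \<in> G \<Longrightarrow> g x = 0 \<longleftrightarrow> x = 0"
  using inverse_G linear_G linear_0 by metis

lemma surj_G: "g \<in> G \<Longrightarrow> surj g"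
  using inverse_G by (metis surjI)

text \<open>A common Lipschitz constant for the operators in \<open>G\<close>, chosen as a sum because it is applied to orbit sums.\<close>

definition bound_G :: real
  where "bound_G = (\<Sum>g\<in>G. onorm g)"

lemma bound_G_nonneg: "0 \<le> bound_G"
  unfolding bound_G_def by (intro sum_nonneg onorm_pos_le bounded_linear_G)

lemma sum_norm_G_le: "(\<Sum>g\<in>G. norm (g x)) \<le> bound_G * norm x"
  unfolding bound_G_def sum_distrib_right by (intro sum_mono onorm bounded_linear_G)

lemma orbit_sum_invariant:
  assumes "h \<in> G"
  shows "orbit_sum G M (h x) = orbit_sum G M x"
proof -
  obtain k where k: "k \<in> G" "\<And>x. k (h x) = x" "\<And>x. h (k x) = x"
    using inverse_G[OF assms] by blast
  have "bij_betw (\<lambda>g x. g (h x)) G G"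
    using assms k comp_G by (intro bij_betw_byWitness[where f' = "\<lambda>g x. g (k x)"]) auto
  from sum.reindex_bij_betw[OF this, of "\<lambda>g. M (g x)"]
  show ?thesis unfolding orbit_sum_def by simp
qed

lemma orbit_sum_bounds:
  assumes M: "norm_on M" and lo: "\<And>x. norm x / 2 \<le> M x" and hi: "\<And>x. M x \<le> B * norm x"
    and B: "0 \<le> B"
  shows "norm_on (orbit_sum G M)"
    and "norm x / 2 \<le> orbit_sum G M x" and "orbit_sum G M x \<le> B * bound_G * norm x"
proof -
  have nn: "0 \<le> M x" for x using M unfolding norm_on_def by blast
  have ge: "M x \<le> orbit_sum G M x" for x
    unfolding orbit_sum_def using member_le_sum[OF id_G, of "\<lambda>g. M (g x)"] nn finite_G by simp
  show lower: "norm x / 2 \<le> orbit_sum G M x" for x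
    using ge[of x] lo[of x] by simp
  have "orbit_sum G M x \<le> (\<Sum>g\<in>G. B * norm (g x))"
    unfolding orbit_sum_def by (intro sum_mono hi)
  also have "\<dots> \<le> B * (bound_G * norm x)"
    unfolding sum_distrib_left[symmetric] by (intro mult_left_mono sum_norm_G_le B)
  finally show "orbit_sum G M x \<le> B * bound_G * norm x" by (simp add: mult.assoc)
  show "norm_on (orbit_sum G M)"
    unfolding norm_on_def
  proof (intro conjI allI)
    show "0 \<le> orbit_sum G M x" for x
      unfolding orbit_sum_def by (intro sum_nonneg nn)
    have "orbit_sum G M 0 = 0"
      unfolding orbit_sum_def using M
      by (intro sum.neutral ballI) (simp add: linear_0[OF linear_G] norm_on_def)
    then show "(orbit_sum G M x = 0) = (x = 0)" for x
      using lower[of x] by auto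
    show "orbit_sum G M (c *\<^sub>R x) = \<bar>c\<bar> * orbit_sum G M x" for c x
      unfolding orbit_sum_def sum_distrib_left
      using M by (intro sum.cong refl) (simp add: linear_cmul[OF linear_G] norm_on_def)
    show "orbit_sum G M (x + y) \<le> orbit_sum G M x + orbit_sum G M y" for x y
      unfolding orbit_sum_def sum.distrib[symmetric]
      using M by (intro sum_mono) (simp add: linear_add[OF linear_G] norm_on_def)
  qed
qed

lemma second_difference_orbit_sum:
  "second_difference (orbit_sum G M) x v t = (\<Sum>g\<in>G. second_difference M (g x) (g v) t)"
  unfolding second_difference_def orbit_sum_def
  by (simp add: sum_divide_distrib[symmetric] sum_subtractf sum.distrib sum_distrib_left
      linear_add[OF linear_G] linear_diff[OF linear_G] linear_cmul[OF linear_G] cong: sum.cong)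

lemma equivalent_orbit_sum:
  assumes "norm_on M" "\<And>x. norm x / 2 \<le> M x" "\<And>x. M x \<le> B * norm x" "0 \<le> B"
  shows "equivalent_norm (orbit_sum G M)"
proof -
  have upper: "orbit_sum G M x \<le> (B * bound_G + 1) * norm x" for x
  proof -
    have "orbit_sum G M x \<le> B * bound_G * norm x + norm x"
      using orbit_sum_bounds(3)[OF assms, of x] norm_ge_zero[of x] by linarith
    then show ?thesis by (simp add: algebra_simps)
  qed
  have pos: "0 < B * bound_G + 1" using assms(4) bound_G_nonneg by (simp add: add_nonneg_pos)
  have "\<exists>C>0. \<forall>x. 1 / 2 * norm x \<le> orbit_sum G M x \<and> orbit_sum G M x \<le> C * norm x"
    using orbit_sum_bounds(2)[OF assms] upper by (intro exI[of _ "B * bound_G + 1"]) (simp add: pos)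
  moreover have "0 < (1 / 2 :: real)" by simp
  ultimately have "\<exists>c>0. \<exists>C>0. \<forall>x. c * norm x \<le> orbit_sum G M x \<and> orbit_sum G M x \<le> C * norm x"
    by (rule_tac exI[of _ "1 / 2 :: real"], rule_tac conjI)
  then show ?thesis
    unfolding equivalent_norm_def using orbit_sum_bounds(1)[OF assms] by (rule conjI[rotated])
qed

lemma G_subset_isometries: "G \<subseteq> isometries (orbit_sum G M)"
  unfolding isometries_def using linear_G surj_G orbit_sum_invariant by blast

end

lemma group_imp_finite_operator_group:
  assumes G: "isomorphism_group G" and "finite G" and neg: "(\<lambda>x. - x) \<in> G"
  shows "finite_operator_group G"
proof (rule finite_operator_group.intro)
  have sub: "subgroup G (BijGroup UNIV)" and iso: "\<And>g. g \<in> G \<Longrightarrow> isomorphism g"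
    using G by (auto simp: isomorphism_group_def)
  show "finite G" "(\<lambda>x. - x) \<in> G" by fact+
  show "bounded_linear g" if "g \<in> G" for g using iso[OF that] by (simp add: isomorphism_def)
  show "(\<lambda>x. x) \<in> G" using subgroup.one_closed[OF sub] by (simp add: BijGroup_def restrict_def)
  have Bij: "g \<in> Bij UNIV" if "g \<in> G" for g
    using subgroup.subset[OF sub] that by (auto simp: BijGroup_def)
  show "(\<lambda>x. g (h x)) \<in> G" if "g \<in> G" "h \<in> G" for g h
    using subgroup.m_closed[OF sub that] Bij[OF that(1)] Bij[OF that(2)]
    by (simp add: BijGroup_def compose_def restrict_def)
  show "\<exists>h\<in>G. (\<forall>x. h (g x) = x) \<and> (\<forall>x. g (h x) = x)" if g: "g \<in> G" for g
  proof
    have "bij g" using iso[OF g] by (simp add: isomorphism_def)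
    show "inv_into UNIV g \<in> G"
      using subgroup.m_inv_closed[OF sub g] inv_BijGroup[OF Bij[OF g]] by (simp add: restrict_def)
    show "(\<forall>x. inv_into UNIV g (g x) = x) \<and> (\<forall>x. g (inv_into UNIV g x) = x)"
      using \<open>bij g\<close> by (simp add: bij_is_inj bij_is_surj surj_f_inv_f)
  qed
qed

text \<open>Every linear map is multiplication by a scalar here, so an isometry of any norm is \<open>\<plusminus>Id\<close>.\<close>

lemma (in finite_operator_group) isometries_of_spanned_space:
  fixes e :: 'a
  assumes span: "\<And>x. \<exists>c. x = c *\<^sub>R e"
  shows "isometries (orbit_sum G norm) = G"
proof (rule antisym[OF _ G_subset_isometries])
  have norm: "norm_on (norm :: 'a \<Rightarrow> real)" by (simp add: norm_on_def norm_triangle_ineq)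
  have N: "norm_on (orbit_sum G norm)"
    using orbit_sum_bounds(1)[OF norm, of 1] by simp
  show "isometries (orbit_sum G norm) \<subseteq> G"
  proof
    fix T assume T: "T \<in> isometries (orbit_sum G norm)"
    then have lin: "linear T" by (simp add: isometries_def)
    obtain c where c: "T e = c *\<^sub>R e" using span by blast
    have "\<bar>c\<bar> * orbit_sum G norm e = orbit_sum G norm e"
      using T c N by (metis (mono_tags, lifting) isometries_def mem_Collect_eq norm_on_def)
    then have "e = 0 \<or> \<bar>c\<bar> = 1" using N by (simp add: norm_on_def)
    then have "T e = e \<or> T e = - e" using c by (auto simp: abs_if split: if_splits)
    then have "(\<forall>x. T x = x) \<or> (\<forall>x. T x = - x)"
      using span linear_cmul[OF lin] by (metis scaleR_minus_right)
    then have "T = (\<lambda>x. x) \<or> T = (\<lambda>x. - x)" by auto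
    then show "T \<in> G" using id_G minus_G by auto
  qed
qed

section \<open>The isometries of a kinked norm\<close>

text \<open>
The data of the construction: a smooth norm \<open>q\<close> and functionals \<open>\<phi> n\<close> whose absolute values put kinks into it.
The assumptions that carry the proof are these.
\<^item> \<open>\<phi>_independent\<close>: no two of the hyperplanes \<open>ker (\<phi> n \<circ> g)\<close> coincide, except those of \<open>g\<close> and \<open>-g\<close>, so that a
  hyperplane reveals its \<open>n\<close>, and its \<open>g\<close> up to sign.
\<^item> The last bound on \<open>r\<close>: consecutive weights differ by a factor that no isometry can bridge. The quantity
  \<open>2 * (1 + K) * bound_G\<close> bounds the operator norm of every isometry, whatever \<open>q\<close>, \<open>\<phi>\<close> and \<open>r\<close> are.
\<^item> \<open>\<phi>_close\<close> and \<open>\<phi>_0_distinguishes\<close>: an isometry that acts on each \<open>\<phi> n\<close> like some element of \<open>G\<close> must use the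
  same element for all \<open>n\<close>.
The vector \<open>e\<close> normalises the functionals: proportional functionals that agree at \<open>e\<close> are equal.
\<close>

locale kinked_norm_data = finite_operator_group G for G :: "('a::banach \<Rightarrow> 'a) set" +
  fixes q :: "'a \<Rightarrow> real" and \<phi> :: "nat \<Rightarrow> 'a \<Rightarrow>\<^sub>L real" and r K \<delta> :: real and e :: 'a
  assumes norm_on_q: "norm_on q"
    and q_lower: "\<And>x. norm x / 2 \<le> q x" and q_upper: "\<And>x. q x \<le> norm x"
    and q_smooth: "\<And>x v. x \<noteq> 0 \<Longrightarrow> (second_difference q x v \<longlongrightarrow> 0) (at_right 0)"
    and norm_\<phi>: "\<And>n. norm (\<phi> n) \<le> K"
    and \<phi>_e: "\<And>n. \<phi> n e = 1"
    and \<phi>_separating: "\<And>x. (\<And>n. \<phi> n x = 0) \<Longrightarrow> x = 0"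
    and \<phi>_independent: "\<And>g m n. g \<in> G \<Longrightarrow> (\<And>y. \<phi> m y = 0 \<Longrightarrow> \<phi> n (g y) = 0)
        \<Longrightarrow> m = n \<and> (g = (\<lambda>x. x) \<or> g = (\<lambda>x. - x))"
    and r: "0 < r" "r \<le> 1 / 2" "r * (K * (2 * (1 + K) * bound_G) * norm e) < 1"
    and \<phi>_close: "\<And>n. norm (\<phi> n - \<phi> 0) \<le> \<delta>"
    and \<phi>_0_distinguishes: "\<And>g h. g \<in> G \<Longrightarrow> h \<in> G
        \<Longrightarrow> (\<And>v. \<bar>\<phi> 0 (g v) - \<phi> 0 (h v)\<bar> \<le> 2 * \<delta> * (2 * (1 + K) * bound_G) * norm v) \<Longrightarrow> g = h"
begin

definition distortion :: real where "distortion = 2 * (1 + K) * bound_G"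

definition weight :: "nat \<Rightarrow> real" where "weight n = r ^ Suc n"

definition M :: "'a \<Rightarrow> real" where "M x = q x + (\<Sum>n. weight n * \<bar>\<phi> n x\<bar>)"

definition N :: "'a \<Rightarrow> real" where "N = orbit_sum G M"

text \<open>Half the limit of the second difference of \<open>N\<close> at \<open>x \<noteq> 0\<close>; only the functionals vanishing at \<open>x\<close> contribute.\<close>

definition kink :: "'a \<Rightarrow> 'a \<Rightarrow> real"
  where "kink x v = (\<Sum>g\<in>G. \<Sum>n. weight n * (if \<phi> n (g x) = 0 then \<bar>\<phi> n (g v)\<bar> else 0))"

lemma K_nonneg: "0 \<le> K"
  using norm_\<phi>[of 0] norm_ge_zero[of "\<phi> 0"] by linarith

lemma \<phi>_le: "\<bar>\<phi> n x\<bar> \<le> K * norm x"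
proof -
  have "\<bar>\<phi> n x\<bar> \<le> norm (\<phi> n) * norm x" using norm_blinfun[of "\<phi> n" x] by simp
  also have "\<dots> \<le> K * norm x" by (intro mult_right_mono norm_\<phi>) simp
  finally show ?thesis .
qed

lemma weight_pos: "0 < weight n"
  using r by (simp add: weight_def)

lemma weight_le: "weight n \<le> (1/2) ^ Suc n"
  unfolding weight_def using r by (intro power_mono) auto

lemma weighted_sum:
  assumes "\<And>n. \<bar>a n\<bar> \<le> C"
  shows "summable (\<lambda>n. weight n * a n)" and "(\<Sum>n. weight n * a n) \<le> C"
proof -
  have C: "0 \<le> C" using assms[of 0] by simp
  have s: "(\<lambda>n. (1/2) ^ Suc n * C) sums C"
    using sums_mult2[OF power_half_series, of C] by simp
  have le: "\<bar>weight n * a n\<bar> \<le> (1/2) ^ Suc n * C" for n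
    unfolding abs_mult using weight_pos[of n] by (intro mult_mono assms) (auto simp: weight_le simp del: power_Suc)
  show summable: "summable (\<lambda>n. weight n * a n)"
    by (rule summable_comparison_test'[OF sums_summable[OF s]]) (simp only: real_norm_def le)
  have "(\<Sum>n. weight n * a n) \<le> (\<Sum>n. (1/2) ^ Suc n * C)"
    by (rule suminf_le[OF order_trans[OF abs_ge_self le] summable sums_summable[OF s]])
  then show "(\<Sum>n. weight n * a n) \<le> C" by (simp only: sums_unique[OF s, symmetric])
qed

lemma summable_\<phi>: "summable (\<lambda>n. weight n * \<bar>\<phi> n x\<bar>)"
  using \<phi>_le by (intro weighted_sum(1)[where C = "K * norm x"]) simp

lemma M_bounds: "norm_on M" "norm x / 2 \<le> M x" "M x \<le> (1 + K) * norm x"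
proof -
  have nn: "0 \<le> (\<Sum>n. weight n * \<bar>\<phi> n x\<bar>)" for x
    using weight_pos by (intro suminf_nonneg summable_\<phi>) (simp add: less_imp_le)
  show lower: "norm x / 2 \<le> M x" for x
    using q_lower[of x] nn[of x] by (simp add: M_def)
  show "M x \<le> (1 + K) * norm x"
    using q_upper[of x] weighted_sum(2)[of "\<lambda>n. \<bar>\<phi> n x\<bar>" "K * norm x"] \<phi>_le
    by (simp add: M_def algebra_simps)
  show "norm_on M"
    unfolding norm_on_def
  proof (intro conjI allI)
    show "0 \<le> M x" for x using lower[of x] norm_ge_zero[of x] by linarith
    have "M 0 = 0" using norm_on_q by (simp add: M_def norm_on_def)
    then show "(M x = 0) = (x = 0)" for x using lower[of x] by auto
    show "M (c *\<^sub>R x) = \<bar>c\<bar> * M x" for c x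
    proof -
      have "(\<Sum>n. weight n * \<bar>\<phi> n (c *\<^sub>R x)\<bar>) = (\<Sum>n. \<bar>c\<bar> * (weight n * \<bar>\<phi> n x\<bar>))"
        by (simp add: blinfun.scaleR_right abs_mult mult.left_commute)
      also have "\<dots> = \<bar>c\<bar> * (\<Sum>n. weight n * \<bar>\<phi> n x\<bar>)"
        by (rule suminf_mult[OF summable_\<phi>])
      finally show ?thesis using norm_on_q by (simp add: M_def norm_on_def distrib_left)
    qed
    show "M (x + y) \<le> M x + M y" for x y
    proof -
      have "(\<Sum>n. weight n * \<bar>\<phi> n (x + y)\<bar>) \<le> (\<Sum>n. weight n * \<bar>\<phi> n x\<bar> + weight n * \<bar>\<phi> n y\<bar>)"
      proof (intro suminf_le summable_add summable_\<phi>)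
        show "weight n * \<bar>\<phi> n (x + y)\<bar> \<le> weight n * \<bar>\<phi> n x\<bar> + weight n * \<bar>\<phi> n y\<bar>" for n
          unfolding distrib_left[symmetric] blinfun.add_right
          using weight_pos[of n] by (intro mult_left_mono abs_triangle_ineq) simp
      qed
      also have "\<dots> = (\<Sum>n. weight n * \<bar>\<phi> n x\<bar>) + (\<Sum>n. weight n * \<bar>\<phi> n y\<bar>)"
        by (intro suminf_add[symmetric] summable_\<phi>)
      finally have "(\<Sum>n. weight n * \<bar>\<phi> n (x + y)\<bar>) \<le> (\<Sum>n. weight n * \<bar>\<phi> n x\<bar>) + (\<Sum>n. weight n * \<bar>\<phi> n y\<bar>)" .
      moreover have "q (x + y) \<le> q x + q y" using norm_on_q by (simp add: norm_on_def)
      ultimately show ?thesis unfolding M_def by linarith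
    qed
  qed
qed

text \<open>The smooth part contributes nothing. In the series, the second difference of each term is at most
\<open>weight n * (2 * \<bar>\<phi> n v\<bar>)\<close>, so Tannery's theorem allows the limit to be taken term by term.\<close>

lemma second_difference_M:
  assumes "x \<noteq> 0"
  shows "(second_difference M x v \<longlongrightarrow> 2 * (\<Sum>n. weight n * (if \<phi> n x = 0 then \<bar>\<phi> n v\<bar> else 0))) (at_right 0)"
proof -
  let ?d = "\<lambda>n. second_difference (\<lambda>x. \<bar>\<phi> n x\<bar>) x v"
  have "((\<lambda>t. \<Sum>n. weight n * ?d n t) \<longlongrightarrow> (\<Sum>n. weight n * (if \<phi> n x = 0 then 2 * \<bar>\<phi> n v\<bar> else 0))) (at_right 0)"
  proof (rule tannerys_theorem[THEN conjunct2, THEN conjunct2])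
    show "((\<lambda>t. weight n * ?d n t) \<longlongrightarrow> weight n * (if \<phi> n x = 0 then 2 * \<bar>\<phi> n v\<bar> else 0)) (at_right 0)" for n
      by (intro tendsto_intros second_difference_abs)
    have "norm (weight n * ?d n t) \<le> weight n * (2 * \<bar>\<phi> n v\<bar>)" if "t > 0" for n t
      using second_difference_abs_le[OF that, of "\<phi> n" x v] weight_pos[of n]
      by (simp add: abs_mult)
    then show "\<forall>\<^sub>F (n, t) in at_top \<times>\<^sub>F at_right 0. norm (weight n * ?d n t) \<le> weight n * (2 * \<bar>\<phi> n v\<bar>)"
      unfolding eventually_prod_filter
      by (intro exI[of _ "\<lambda>_. True"] exI[of _ "\<lambda>t. t > 0"]) (auto simp: eventually_at_right_less)
    show "summable (\<lambda>n. weight n * (2 * \<bar>\<phi> n v\<bar>))"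
      using summable_mult[OF summable_\<phi>[of v], of 2] by (simp add: mult.left_commute)
  qed simp
  also have "(\<Sum>n. weight n * (if \<phi> n x = 0 then 2 * \<bar>\<phi> n v\<bar> else 0))
      = (\<Sum>n. 2 * (weight n * (if \<phi> n x = 0 then \<bar>\<phi> n v\<bar> else 0)))"
    by (intro suminf_cong) simp
  also have "\<dots> = 2 * (\<Sum>n. weight n * (if \<phi> n x = 0 then \<bar>\<phi> n v\<bar> else 0))"
    using \<phi>_le K_nonneg by (intro suminf_mult weighted_sum(1)[where C = "K * norm v"]) auto
  finally have lim: "((\<lambda>t. \<Sum>n. weight n * ?d n t) \<longlongrightarrow> 2 * (\<Sum>n. weight n * (if \<phi> n x = 0 then \<bar>\<phi> n v\<bar> else 0))) (at_right 0)" .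
  have "second_difference M x v t = second_difference q x v t + (\<Sum>n. weight n * ?d n t)" for t
  proof -
    let ?s = "\<lambda>y. \<Sum>n. weight n * \<bar>\<phi> n y\<bar>"
    have "(\<lambda>n. (weight n * \<bar>\<phi> n (x + t *\<^sub>R v)\<bar> + weight n * \<bar>\<phi> n (x - t *\<^sub>R v)\<bar> - 2 * (weight n * \<bar>\<phi> n x\<bar>)) / t)
      sums ((?s (x + t *\<^sub>R v) + ?s (x - t *\<^sub>R v) - 2 * ?s x) / t)"
      by (intro sums_divide sums_diff sums_add sums_mult summable_sums summable_\<phi>)
    moreover have "weight n * ?d n t
        = (weight n * \<bar>\<phi> n (x + t *\<^sub>R v)\<bar> + weight n * \<bar>\<phi> n (x - t *\<^sub>R v)\<bar> - 2 * (weight n * \<bar>\<phi> n x\<bar>)) / t" for n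
      unfolding second_difference_def times_divide_eq_right by (simp only: distrib_left right_diff_distrib mult.left_commute)
    ultimately have "(\<Sum>n. weight n * ?d n t) = (?s (x + t *\<^sub>R v) + ?s (x - t *\<^sub>R v) - 2 * ?s x) / t"
      by (simp only: sums_iff)
    then show ?thesis
      unfolding second_difference_def[of M] second_difference_def[of q] M_def
      by (simp only: add_divide_distrib[symmetric]) (simp add: algebra_simps)
  qed
  then have eq: "second_difference M x v = (\<lambda>t. second_difference q x v t + (\<Sum>n. weight n * ?d n t))" by blast
  show ?thesis
    unfolding eq using tendsto_add[OF q_smooth[OF assms] lim] by simp
qed

lemma second_difference_N:
  assumes "x \<noteq> 0"
  shows "(second_difference N x v \<longlongrightarrow> 2 * kink x v) (at_right 0)"
proof -
  have "second_difference N x v = (\<lambda>t. \<Sum>g\<in>G. second_difference M (g x) (g v) t)"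
    unfolding N_def by (rule ext) (rule second_difference_orbit_sum)
  moreover have "((\<lambda>t. \<Sum>g\<in>G. second_difference M (g x) (g v) t) \<longlongrightarrow> 2 * kink x v) (at_right 0)"
    unfolding kink_def sum_distrib_left
    using assms by (intro tendsto_sum second_difference_M) (simp add: G_eq_0_iff)
  ultimately show ?thesis by simp
qed

lemma kink_isometry:
  assumes T: "T \<in> isometries N" and x: "x \<noteq> 0" "T x \<noteq> 0"
  shows "kink (T x) (T v) = kink x v"
proof -
  have "second_difference N (T x) (T v) = second_difference N x v"
  proof
    fix t
    have "linear T" using T by (simp add: isometries_def)
    then have "T x + t *\<^sub>R T v = T (x + t *\<^sub>R v)" "T x - t *\<^sub>R T v = T (x - t *\<^sub>R v)"
      by (simp_all add: linear_add linear_diff linear_cmul)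
    then show "second_difference N (T x) (T v) t = second_difference N x v t"
      using T by (simp add: second_difference_def isometries_def)
  qed
  then have "2 * kink (T x) (T v) = 2 * kink x v"
    using second_difference_N[OF x(1), of v] second_difference_N[OF x(2), of "T v"]
    by (metis tendsto_unique trivial_limit_at_right_real)
  then show ?thesis by simp
qed

lemma summable_kink: "summable (\<lambda>n. weight n * (if \<phi> n (g x) = 0 then \<bar>\<phi> n v\<bar> else 0))"
  using \<phi>_le K_nonneg by (intro weighted_sum(1)[where C = "K * norm v"]) auto

lemma kink_ge:
  assumes "g \<in> G" "\<phi> n (g x) = 0"
  shows "weight n * \<bar>\<phi> n (g v)\<bar> \<le> kink x v"
proof -
  let ?a = "\<lambda>g n. weight n * (if \<phi> n (g x) = 0 then \<bar>\<phi> n (g v)\<bar> else 0)"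
  have nn: "0 \<le> ?a g n" for g n using weight_pos[of n] by simp
  have "weight n * \<bar>\<phi> n (g v)\<bar> = ?a g n" using assms by simp
  also have "\<dots> \<le> (\<Sum>n. ?a g n)"
    using sum_le_suminf[OF summable_kink, of "{n}" g x "g v"] nn by simp
  also have "\<dots> \<le> kink x v"
    unfolding kink_def using assms finite_G
    by (intro member_le_sum[of g G "\<lambda>g. \<Sum>n. ?a g n"] suminf_nonneg summable_kink nn) auto
  finally show ?thesis .
qed

text \<open>If \<open>x\<close> lies on one hyperplane only, exactly two pairs contribute, \<open>(n, g)\<close> and \<open>(n, -g)\<close>.\<close>

lemma kink_eq:
  assumes g: "g \<in> G" and zero: "\<phi> n (g x) = 0"
    and only: "\<And>m h. h \<in> G \<Longrightarrow> \<phi> m (h x) = 0 \<Longrightarrow> m = n \<and> (h = g \<or> h = (\<lambda>x. - g x))"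
  shows "kink x v = 2 * weight n * \<bar>\<phi> n (g v)\<bar>"
proof -
  have neg: "(\<lambda>x. - g x) \<in> G" using comp_G[OF minus_G g] by simp
  have ne: "g \<noteq> (\<lambda>x. - g x)"
  proof
    assume "g = (\<lambda>x. - g x)"
    then have "g e = - g e" by metis
    then have "g e + g e = 0" by (metis eq_neg_iff_add_eq_0)
    then have "2 *\<^sub>R g e = 0" by (simp add: scaleR_2)
    then have "e = 0" using G_eq_0_iff[OF g] by simp
    then show False using \<phi>_e[of 0] by simp
  qed
  have inner: "(\<Sum>m. weight m * (if \<phi> m (h x) = 0 then \<bar>\<phi> m (h v)\<bar> else 0))
      = (if h \<in> {g, \<lambda>x. - g x} then weight n * \<bar>\<phi> n (g v)\<bar> else 0)" if h: "h \<in> G" for h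
  proof -
    have "(\<Sum>m. weight m * (if \<phi> m (h x) = 0 then \<bar>\<phi> m (h v)\<bar> else 0))
      = (\<Sum>m\<in>{n}. weight m * (if \<phi> m (h x) = 0 then \<bar>\<phi> m (h v)\<bar> else 0))"
      using only[OF h] by (intro suminf_finite) auto
    then show ?thesis
      using only[OF h, of n] zero by (auto simp: blinfun.minus_right)
  qed
  have "kink x v = (\<Sum>h\<in>G. if h \<in> {g, \<lambda>x. - g x} then weight n * \<bar>\<phi> n (g v)\<bar> else 0)"
    unfolding kink_def by (intro sum.cong refl inner)
  also have "\<dots> = (\<Sum>h\<in>{g, \<lambda>x. - g x}. weight n * \<bar>\<phi> n (g v)\<bar>)"
    using g neg finite_G by (intro sum.mono_neutral_cong_right) auto
  also have "\<dots> = 2 * weight n * \<bar>\<phi> n (g v)\<bar>" using ne by simp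
  finally show ?thesis .
qed

text \<open>By independence, every other hyperplane meets \<open>ker (\<phi> n)\<close> in a proper subspace, and there are only countably many of
them.\<close>

lemma generic_kernel_point:
  obtains y where "y \<noteq> 0" "\<phi> n y = 0"
    "\<And>m g. g \<in> G \<Longrightarrow> \<phi> m (g y) = 0 \<Longrightarrow> m = n \<and> (g = (\<lambda>x. x) \<or> g = (\<lambda>x. - x))"
proof -
  define I where "I = {(m, g). g \<in> G \<and> \<not> (m = n \<and> (g = (\<lambda>x. x) \<or> g = (\<lambda>x. - x)))}"
  define F where "F = (\<lambda>(m, g) y. \<phi> m (g y)) ` I"
  have "countable ((UNIV :: nat set) \<times> G)" using finite_G by (intro countable_SIGMA) (auto intro: countable_finite)
  then have "countable I" by (rule countable_subset[rotated]) (auto simp: I_def)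
  then have F: "countable F" by (simp add: F_def)
  obtain y where y: "y \<in> {y. \<phi> n y = 0}" "\<And>f. f \<in> F \<Longrightarrow> f y \<noteq> 0"
  proof (rule avoid_countably_many_kernels[of "{y. \<phi> n y = 0}" F])
    show "closed {y. \<phi> n y = 0}"
      by (intro closed_Collect_eq continuous_intros)
    show "subspace {y. \<phi> n y = 0}"
      by (simp add: subspace_def blinfun.add_right blinfun.scaleR_right)
    show "bounded_linear f" if "f \<in> F" for f
      using that bounded_linear_G bounded_linear_compose[OF blinfun.bounded_linear_right]
      by (auto simp: F_def I_def)
    show "\<exists>y\<in>{y. \<phi> n y = 0}. f y \<noteq> 0" if f: "f \<in> F" for f
    proof (rule ccontr)
      assume no: "\<not> ?thesis"
      obtain m g where mg: "g \<in> G" "\<not> (m = n \<and> (g = (\<lambda>x. x) \<or> g = (\<lambda>x. - x)))" "f = (\<lambda>y. \<phi> m (g y))"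
        using f unfolding F_def I_def by auto
      have "\<phi> m (g y) = 0" if "\<phi> n y = 0" for y using no that mg(3) by simp
      from \<phi>_independent[OF mg(1) this] mg(2) show False by blast
    qed
  qed (use F in auto)
  have *: "m = n \<and> (g = (\<lambda>x. x) \<or> g = (\<lambda>x. - x))" if "g \<in> G" "\<phi> m (g y) = 0" for m g
    using y(2)[of "\<lambda>y. \<phi> m (g y)"] that by (force simp: F_def I_def)
  \<comment> \<open>The hyperplane of another index passes through \<open>0\<close> but not through \<open>y\<close>.\<close>
  have "\<phi> (Suc n) y \<noteq> 0" using *[OF id_G, of "Suc n"] by auto
  then have "y \<noteq> 0" by auto
  then show ?thesis using that y(1) * by blast
qed

lemma N_bounds: "norm_on N" "norm x / 2 \<le> N x" "N x \<le> (1 + K) * bound_G * norm x"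
  unfolding N_def using orbit_sum_bounds[OF M_bounds] K_nonneg by auto

lemma norm_le_of_N_eq:
  assumes "N x = N y"
  shows "norm x \<le> distortion * norm y"
proof -
  have "norm x \<le> 2 * ((1 + K) * bound_G * norm y)"
    using N_bounds(2)[of x] N_bounds(3)[of y] assms by linarith
  then show ?thesis by (simp only: distortion_def mult.assoc)
qed

text \<open>Let \<open>x\<close> be the preimage of a generic point of \<open>ker (\<phi> n)\<close>. The kink of \<open>N\<close> at \<open>x\<close> is then a multiple of
\<open>\<bar>\<phi> n (T v)\<bar>\<close>, hence not zero, so \<open>x\<close> lies on some hyperplane \<open>ker (\<phi> m \<circ> h)\<close>. As the kink vanishes for \<open>v\<close> in
\<open>ker (\<phi> n \<circ> T)\<close>, every hyperplane through \<open>x\<close> equals \<open>ker (\<phi> n \<circ> T)\<close>; by independence only \<open>\<plusminus>h\<close> with index \<open>m\<close>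
occur.\<close>

lemma isometry_transports_kernels:
  assumes T: "T \<in> isometries N"
  obtains m h where "h \<in> G" "\<And>v. weight n * \<bar>\<phi> n (T v)\<bar> = weight m * \<bar>\<phi> m (h v)\<bar>"
proof -
  have lin: "linear T" and surj: "surj T" using T by (simp_all add: isometries_def)
  obtain y where y: "y \<noteq> 0" "\<phi> n y = 0"
    "\<And>m g. g \<in> G \<Longrightarrow> \<phi> m (g y) = 0 \<Longrightarrow> m = n \<and> (g = (\<lambda>x. x) \<or> g = (\<lambda>x. - x))"
    using generic_kernel_point by metis
  obtain x where x: "T x = y" using surj by (metis surjD)
  have "x \<noteq> 0" using x y(1) linear_0[OF lin] by auto
  have kink_x: "kink x v = 2 * weight n * \<bar>\<phi> n (T v)\<bar>" for v
    using kink_isometry[OF T \<open>x \<noteq> 0\<close>, of v] kink_eq[OF id_G, of n y "T v"] y x by simp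
  obtain w where w: "T w = e" using surj by (metis surjD)
  have "\<exists>m. \<exists>h\<in>G. \<phi> m (h x) = 0"
  proof (rule ccontr)
    assume "\<not> ?thesis"
    then have "\<phi> m (h x) \<noteq> 0" if "h \<in> G" for m h using that by blast
    then have "kink x w = 0" unfolding kink_def by (intro sum.neutral ballI) simp
    then show False using kink_x[of w] weight_pos[of n] by (simp add: w \<phi>_e)
  qed
  then obtain m h where h: "h \<in> G" "\<phi> m (h x) = 0" by blast
  have vanish: "\<phi> m' (h' v) = 0" if "h' \<in> G" "\<phi> m' (h' x) = 0" "\<phi> n (T v) = 0" for m' h' v
    using kink_ge[OF that(1,2), of v] kink_x[of v] that(3) weight_pos[of m'] by (simp add: mult_le_0_iff)
  have factor: "\<phi> m (h v) = \<phi> n (T v) * \<phi> m (h w)" for v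
  proof -
    have "\<phi> n (T (v - \<phi> n (T v) *\<^sub>R w)) = 0"
      by (simp add: linear_diff[OF lin] linear_cmul[OF lin] w \<phi>_e blinfun.diff_right blinfun.scaleR_right)
    from vanish[OF h this] show ?thesis
      using linear_G[OF h(1)] by (simp add: linear_diff linear_cmul blinfun.diff_right blinfun.scaleR_right)
  qed
  obtain k where k: "k \<in> G" "\<And>x. k (h x) = x" "\<And>x. h (k x) = x"
    using inverse_G[OF h(1)] by blast
  have "\<phi> m (h w) \<noteq> 0" using factor[of "k e"] k(3) \<phi>_e[of m] by auto
  have only: "m' = m \<and> (h' = h \<or> h' = (\<lambda>x. - h x))" if h': "h' \<in> G" "\<phi> m' (h' x) = 0" for m' h'
  proof -
    have "\<phi> m' (h' (k u)) = 0" if "\<phi> m u = 0" for u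
      using vanish[OF h', of "k u"] factor[of "k u"] k(3) that \<open>\<phi> m (h w) \<noteq> 0\<close> by simp
    from \<phi>_independent[OF comp_G[OF h'(1) k(1)] this]
    have m: "m = m'" and hk: "(\<lambda>x. h' (k x)) = (\<lambda>x. x) \<or> (\<lambda>x. h' (k x)) = (\<lambda>x. - x)" by blast+
    from hk have "(\<forall>x. h' (k (h x)) = h x) \<or> (\<forall>x. h' (k (h x)) = - h x)"
      by (auto dest: fun_cong)
    then show ?thesis using m k(2) by auto
  qed
  have "weight n * \<bar>\<phi> n (T v)\<bar> = weight m * \<bar>\<phi> m (h v)\<bar>" for v
    using kink_eq[OF h only, of v] kink_x[of v] by simp
  then show ?thesis using that h(1) by blast
qed

lemma weights_separated:
  assumes "n < m"
  shows "weight m * (K * distortion * norm e) < weight n"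
proof -
  have "0 \<le> K * distortion * norm e" using K_nonneg bound_G_nonneg by (simp add: distortion_def)
  moreover have "weight m \<le> r * weight n"
    using assms r power_decreasing[of "Suc (Suc n)" "Suc m" r] by (simp add: weight_def)
  ultimately have "weight m * (K * distortion * norm e) \<le> r * weight n * (K * distortion * norm e)"
    by (rule mult_right_mono[rotated])
  also have "\<dots> = weight n * (r * (K * distortion * norm e))" by simp
  also have "\<dots> < weight n * 1"
    using r(3) weight_pos[of n] by (intro mult_strict_left_mono) (auto simp: distortion_def mult.assoc)
  finally show ?thesis by simp
qed

text \<open>The weights identify the index. Evaluating the equality of \<open>isometry_transports_kernels\<close> where \<open>T\<close>, respectively \<open>h\<close>,
takes the value \<open>e\<close> bounds each of the two weights by a fixed multiple of the other one, so \<open>m = n\<close>. The sign left open by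
the absolute values is absorbed by \<open>-Id \<in> G\<close>.\<close>

lemma isometry_acts_by_group:
  assumes T: "T \<in> isometries N"
  obtains g where "g \<in> G" "\<And>v. \<phi> n (T v) = \<phi> n (g v)"
proof -
  have lin: "linear T" and surj: "surj T" using T by (simp_all add: isometries_def)
  obtain m h where h: "h \<in> G" and eq: "\<And>v. weight n * \<bar>\<phi> n (T v)\<bar> = weight m * \<bar>\<phi> m (h v)\<bar>"
    using isometry_transports_kernels[OF T] by metis
  have N_T: "N (T v) = N v" and N_h: "N (h v) = N v" for v
    using T h G_subset_isometries[of M] by (auto simp: isometries_def N_def)
  have le: "\<bar>\<phi> i u\<bar> \<le> K * distortion * norm e" if "N u = N e" for i u
  proof -
    have "\<bar>\<phi> i u\<bar> \<le> K * norm u" by (rule \<phi>_le)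
    also have "\<dots> \<le> K * (distortion * norm e)" by (rule mult_left_mono[OF norm_le_of_N_eq[OF that] K_nonneg])
    finally show ?thesis by (simp add: mult.assoc)
  qed
  have "\<not> n < m"
  proof
    assume "n < m"
    obtain w where w: "T w = e" using surj by (metis surjD)
    have "N (h w) = N e" using N_T[of w] N_h[of w] w by simp
    then have "weight m * \<bar>\<phi> m (h w)\<bar> \<le> weight m * (K * distortion * norm e)"
      by (intro mult_left_mono le) (simp_all add: weight_pos[THEN less_imp_le])
    then show False using eq[of w] weights_separated[OF \<open>n < m\<close>] by (simp add: w \<phi>_e)
  qed
  moreover have "\<not> m < n"
  proof
    assume "m < n"
    obtain w where w: "h w = e" using surj_G[OF h] by (metis surjD)
    have "N (T w) = N e" using N_T[of w] N_h[of w] w by simp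
    then have "weight n * \<bar>\<phi> n (T w)\<bar> \<le> weight n * (K * distortion * norm e)"
      by (intro mult_left_mono le) (simp_all add: weight_pos[THEN less_imp_le])
    then show False using eq[of w] weights_separated[OF \<open>m < n\<close>] by (simp add: w \<phi>_e)
  qed
  ultimately have "m = n" by simp
  then have "\<bar>\<phi> n (T v)\<bar> = \<bar>\<phi> n (h v)\<bar>" for v
    using eq[of v] weight_pos[of n] by simp
  then have "(\<forall>v. \<phi> n (T v) = \<phi> n (h v)) \<or> (\<forall>v. \<phi> n (T v) = - \<phi> n (h v))"
    using linear_compose[OF lin bounded_linear.linear[OF blinfun.bounded_linear_right[of "\<phi> n"]]]
      linear_compose[OF linear_G[OF h] bounded_linear.linear[OF blinfun.bounded_linear_right[of "\<phi> n"]]]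
    by (intro linear_functionals_abs_eq) (simp_all add: o_def)
  then show ?thesis
  proof
    assume "\<forall>v. \<phi> n (T v) = \<phi> n (h v)"
    then show ?thesis using that h by blast
  next
    assume "\<forall>v. \<phi> n (T v) = - \<phi> n (h v)"
    then show ?thesis using that[of "\<lambda>v. - h v"] comp_G[OF minus_G h] by (simp add: blinfun.minus_right)
  qed
qed

text \<open>Since \<open>\<phi> n\<close> is within \<open>\<delta>\<close> of \<open>\<phi> 0\<close>, the functionals \<open>\<phi> 0 \<circ> g n\<close> and \<open>\<phi> 0 \<circ> g 0\<close> are both close to
\<open>\<phi> n \<circ> T\<close>, too close for different elements of \<open>G\<close>.\<close>

theorem isometries_eq_G: "isometries N = G"
proof (rule antisym)
  show "G \<subseteq> isometries N" using G_subset_isometries by (simp add: N_def)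
  show "isometries N \<subseteq> G"
  proof
    fix T assume T: "T \<in> isometries N"
    then have "\<forall>n. \<exists>g\<in>G. \<forall>v. \<phi> n (T v) = \<phi> n (g v)"
      using isometry_acts_by_group by metis
    then obtain g where g: "\<And>n. g n \<in> G" "\<And>n v. \<phi> n (T v) = \<phi> n (g n v)" by metis
    have close: "\<bar>\<phi> n u - \<phi> 0 u\<bar> \<le> \<delta> * (distortion * norm v)" if "N u = N v" for n u v
    proof -
      have "\<bar>\<phi> n u - \<phi> 0 u\<bar> \<le> norm (\<phi> n - \<phi> 0) * norm u"
        using norm_blinfun[of "\<phi> n - \<phi> 0" u] by (simp add: blinfun.diff_left)
      also have "\<dots> \<le> \<delta> * (distortion * norm v)"
        using \<phi>_close[of 0] by (intro mult_mono \<phi>_close norm_le_of_N_eq that) auto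
      finally show ?thesis .
    qed
    have "g n = g 0" for n
    proof (rule \<phi>_0_distinguishes[OF g(1) g(1)])
      fix v
      have "N (g n v) = N v" "N (T v) = N v"
        using T g(1)[of n] G_subset_isometries[of M] by (auto simp: isometries_def N_def)
      then have "\<bar>\<phi> n (g n v) - \<phi> 0 (g n v)\<bar> \<le> \<delta> * (distortion * norm v)"
        "\<bar>\<phi> n (T v) - \<phi> 0 (T v)\<bar> \<le> \<delta> * (distortion * norm v)"
        by (simp_all add: close)
      then have "\<bar>\<phi> 0 (g n v) - \<phi> 0 (g 0 v)\<bar> \<le> 2 * (\<delta> * (distortion * norm v))"
        using g(2)[of n v] g(2)[of 0 v] by linarith
      then show "\<bar>\<phi> 0 (g n v) - \<phi> 0 (g 0 v)\<bar> \<le> 2 * \<delta> * (2 * (1 + K) * bound_G) * norm v"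
        by (simp add: distortion_def mult.assoc)
    qed
    note same = this
    have "\<phi> n (T v - g 0 v) = 0" for n v
      using g(2)[of n v] same[of n] by (simp add: blinfun.diff_right)
    then have "T v - g 0 v = 0" for v by (rule \<phi>_separating)
    then have "T = g 0" by auto
    then show "T \<in> G" using g(1) by simp
  qed
qed

lemma equivalent_norm_N: "equivalent_norm N"
  unfolding N_def using equivalent_orbit_sum[OF M_bounds] K_nonneg by simp

end

section \<open>Choice of the functionals\<close>

lemma functional_nonzero_at:
  fixes x :: "'a::real_normed_vector"
  assumes "separable_space (euclidean :: 'a topology)" "x \<noteq> 0"
  obtains f :: "'a \<Rightarrow>\<^sub>L real" where "f x \<noteq> 0"
proof -
  obtain f :: "'a \<Rightarrow>\<^sub>L real" where "norm x / 2 \<le> f x"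
    using separable_hahn_banach[OF assms(1)] by metis
  then show ?thesis using that[of f] assms(2) by force
qed

text \<open>Left multiplication by \<open>g\<close> permutes the summands of \<open>\<Sum>h\<in>G. \<bar>f (h e)\<bar>\<close> and at the same time multiplies each of
them by \<open>\<bar>c\<bar>\<close>.\<close>

lemma (in finite_operator_group) eigenvalue_abs_1:
  fixes f :: "'a \<Rightarrow>\<^sub>L real"
  assumes g: "g \<in> G" and eigen: "\<And>v. f (g v) = c * f v" and f: "f e \<noteq> 0"
  shows "\<bar>c\<bar> = 1"
proof -
  obtain k where k: "k \<in> G" "\<And>x. k (g x) = x" "\<And>x. g (k x) = x"
    using inverse_G[OF g] by blast
  have "bij_betw (\<lambda>h x. g (h x)) G G"
    using g k comp_G by (intro bij_betw_byWitness[where f' = "\<lambda>h x. k (h x)"]) auto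
  from sum.reindex_bij_betw[OF this, of "\<lambda>h. \<bar>f (h e)\<bar>"]
  have "\<bar>c\<bar> * (\<Sum>h\<in>G. \<bar>f (h e)\<bar>) = (\<Sum>h\<in>G. \<bar>f (h e)\<bar>)"
    by (simp add: eigen abs_mult sum_distrib_left)
  moreover have "0 < (\<Sum>h\<in>G. \<bar>f (h e)\<bar>)"
    using f by (intro sum_pos2[OF finite_G id_G]) auto
  ultimately show ?thesis by simp
qed

text \<open>For each pair \<open>g \<noteq> h\<close> pick \<open>v\<close> with \<open>g v \<noteq> h v\<close>. The functionals that fail to distinguish the pair at \<open>v\<close> form the
kernel of an evaluation on the dual space, and finitely many proper kernels do not cover that space.\<close>

lemma (in finite_operator_group) distinguishing_functional:
  assumes sep: "separable_space (euclidean :: 'a topology)"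
  obtains f :: "'a \<Rightarrow>\<^sub>L real"
  where "\<And>g h. g \<in> G \<Longrightarrow> h \<in> G \<Longrightarrow> g \<noteq> h \<Longrightarrow> \<exists>v. f (g v) \<noteq> f (h v)"
proof -
  have "\<exists>v. g v \<noteq> h v" if "g \<noteq> h" for g h :: "'a \<Rightarrow> 'a" using that by blast
  then obtain v where v: "\<And>g h :: 'a \<Rightarrow> 'a. g \<noteq> h \<Longrightarrow> g (v g h) \<noteq> h (v g h)" by metis
  define E where "E = (\<lambda>(g, h) (f :: 'a \<Rightarrow>\<^sub>L real). f (g (v g h) - h (v g h))) ` {(g, h) \<in> G \<times> G. g \<noteq> h}"
  have "finite {(g, h) \<in> G \<times> G. g \<noteq> h}"
    using finite_G by (rule_tac finite_subset[of _ "G \<times> G"]) auto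
  then have "countable E" by (simp add: E_def countable_finite)
  then obtain f where f: "\<And>p. p \<in> E \<Longrightarrow> p f \<noteq> 0"
  proof (rule avoid_countably_many_kernels[of UNIV, rotated 2])
    show "bounded_linear p" if "p \<in> E" for p
      using that by (auto simp: E_def intro: blinfun.bounded_linear_left)
    show "\<exists>f\<in>UNIV. p f \<noteq> 0" if p: "p \<in> E" for p
    proof -
      obtain g h where gh: "g \<noteq> h" "p = (\<lambda>f. f (g (v g h) - h (v g h)))"
        using p by (auto simp: E_def)
      then have "g (v g h) - h (v g h) \<noteq> 0" using v by simp
      then obtain f :: "'a \<Rightarrow>\<^sub>L real" where "f (g (v g h) - h (v g h)) \<noteq> 0"
        using functional_nonzero_at[OF sep] by metis
      then show ?thesis using gh by auto
    qed
  qed (auto simp: subspace_def)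
  have "\<exists>v. f (g v) \<noteq> f (h v)" if gh: "g \<in> G" "h \<in> G" "g \<noteq> h" for g h
  proof -
    have "(\<lambda>f. blinfun_apply f (g (v g h) - h (v g h))) \<in> E" using gh by (force simp: E_def)
    from f[OF this] show ?thesis by (auto simp: blinfun.diff_right)
  qed
  then show ?thesis using that by blast
qed

text \<open>If \<open>ker f\<close> were contained in \<open>ker (f \<circ> g)\<close>, then \<open>f \<circ> g = c f\<close> with \<open>\<bar>c\<bar> = 1\<close>, and \<open>f\<close> would not distinguish \<open>g\<close>
from both \<open>Id\<close> and \<open>-Id\<close>.\<close>

lemma (in finite_operator_group) distinguishing_functional_kernel:
  fixes f :: "'a \<Rightarrow>\<^sub>L real"
  assumes dist: "\<And>g h. g \<in> G \<Longrightarrow> h \<in> G \<Longrightarrow> g \<noteq> h \<Longrightarrow> \<exists>v. f (g v) \<noteq> f (h v)"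
    and e: "f e = 1" and g: "g \<in> G" "g \<noteq> (\<lambda>x. x)" "g \<noteq> (\<lambda>x. - x)"
  obtains y where "f y = 0" "f (g y) \<noteq> 0"
proof -
  have "\<exists>y. f y = 0 \<and> f (g y) \<noteq> 0"
  proof (rule ccontr)
    assume "\<not> ?thesis"
    then have kernel: "f (g (v - f v *\<^sub>R e)) = 0" for v
      by (simp add: e blinfun.diff_right blinfun.scaleR_right)
    define c where "c = f (g e)"
    have eigen: "f (g v) = c * f v" for v
      using kernel[of v] linear_G[OF g(1)] unfolding c_def
      by (simp add: linear_diff linear_cmul blinfun.diff_right blinfun.scaleR_right)
    have "\<bar>c\<bar> = 1" using e by (intro eigenvalue_abs_1[OF g(1) eigen, of e]) simp
    then have "(\<forall>v. f (g v) = f v) \<or> (\<forall>v. f (g v) = f (- v))"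
      unfolding eigen by (auto simp: abs_if blinfun.minus_right split: if_splits)
    then show False using dist[OF g(1) id_G g(2)] dist[OF g(1) minus_G g(3)] by auto
  qed
  then show ?thesis using that by blast
qed

text \<open>Take a separating sequence, project it onto the functionals vanishing at \<open>e\<close>, and add small multiples of the results
to \<open>f\<close>; \<open>f\<close> together with the projections still separates points. The multiples are scaled so that the distances to
\<open>f\<close> are \<open>\<delta> / n\<close>, which makes the sequence injective. The vector \<open>x\<close> outside the span of \<open>e\<close> provides a nonzero functional
vanishing at \<open>e\<close>, to replace projections that are \<open>0\<close>.\<close>

lemma close_separating_sequence:
  fixes f :: "'a::real_normed_vector \<Rightarrow>\<^sub>L real"
  assumes sep: "separable_space (euclidean :: 'a topology)"
    and e: "f e = 1" and dim: "\<And>c. x \<noteq> c *\<^sub>R e" and \<delta>: "0 < \<delta>"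
  obtains \<phi> :: "nat \<Rightarrow> 'a \<Rightarrow>\<^sub>L real"
  where "\<phi> 0 = f" "inj \<phi>" "\<And>n. \<phi> n e = 1" "\<And>n. norm (\<phi> n - f) \<le> \<delta>"
    "\<And>x. (\<And>n. \<phi> n x = 0) \<Longrightarrow> x = 0"
proof -
  obtain \<eta> :: "nat \<Rightarrow> 'a \<Rightarrow>\<^sub>L real" where \<eta>: "\<And>x. (\<And>n. \<eta> n x = 0) \<Longrightarrow> x = 0"
    using countable_separating_functionals[OF sep] by blast
  define P where "P h = h - h e *\<^sub>R f" for h :: "'a \<Rightarrow>\<^sub>L real"
  have P_e: "P h e = 0" for h
    by (simp add: P_def e blinfun.diff_left blinfun.scaleR_left)
  obtain h :: "'a \<Rightarrow>\<^sub>L real" where "h (x - f x *\<^sub>R e) \<noteq> 0"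
    using functional_nonzero_at[OF sep, of "x - f x *\<^sub>R e"] dim by auto
  then have "P h x \<noteq> 0"
    by (simp add: P_def blinfun.diff_left blinfun.scaleR_left blinfun.diff_right blinfun.scaleR_right mult.commute)
  then have "P h \<noteq> 0" by auto
  define \<zeta> where "\<zeta> n = (if P (\<eta> (n - 1)) = 0 then P h else P (\<eta> (n - 1)))" for n
  have \<zeta>: "\<zeta> n \<noteq> 0" "\<zeta> n e = 0" for n
    using \<open>P h \<noteq> 0\<close> P_e by (auto simp: \<zeta>_def)
  \<comment> \<open>As \<open>\<delta> / 0 = 0\<close>, the term with index \<open>0\<close> is \<open>f\<close>; this is why \<open>\<zeta>\<close> is shifted by one.\<close>
  define \<phi> where "\<phi> n = f + (\<delta> / real n) *\<^sub>R sgn (\<zeta> n)" for n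
  have norm: "norm (\<phi> n - f) = \<delta> / real n" for n
    using \<zeta>(1)[of n] \<delta> by (simp add: \<phi>_def norm_sgn)
  show ?thesis
  proof
    show "\<phi> 0 = f" by (simp add: \<phi>_def)
    show "inj \<phi>"
    proof
      fix m n assume "\<phi> m = \<phi> n"
      then have "\<delta> / real m = \<delta> / real n" using norm by metis
      then have "inverse (real m) = inverse (real n)" using \<delta> by (simp add: divide_inverse)
      then show "m = n" by simp
    qed
    show "\<phi> n e = 1" for n
      using \<zeta>(2)[of n] by (simp add: \<phi>_def sgn_div_norm e blinfun.add_left blinfun.scaleR_left)
    show "norm (\<phi> n - f) \<le> \<delta>" for n
    proof (cases n)
      case (Suc k)
      then show ?thesis using \<delta> norm[of n] by (simp add: divide_le_eq mult_le_cancel_left1)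
    qed (use norm[of 0] \<delta> in simp)
    fix x assume 0: "\<And>n. \<phi> n x = 0"
    then have f: "f x = 0" using 0[of 0] by (simp add: \<phi>_def)
    have "\<zeta> (Suc k) x = 0" for k
      using 0[of "Suc k"] f \<delta> \<zeta>(1)[of "Suc k"]
      by (simp add: \<phi>_def sgn_div_norm blinfun.add_left blinfun.scaleR_left)
    then have "P (\<eta> k) x = 0" for k
      by (metis \<zeta>_def diff_Suc_1 blinfun.zero_left)
    then have "\<eta> k x = 0" for k
      using f by (simp add: P_def blinfun.diff_left blinfun.scaleR_left)
    then show "x = 0" by (rule \<eta>)
  qed
qed

lemma eventually_mult_less_at_right_0:
  fixes A B :: real
  assumes "0 < B"
  shows "\<forall>\<^sub>F \<delta> in at_right 0. \<delta> * A < B"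
proof -
  have "((\<lambda>\<delta>. \<delta> * A) \<longlongrightarrow> 0 * A) (at_right 0)" by (intro tendsto_intros)
  then show ?thesis using assms by (intro order_tendstoD(2)) auto
qed

section \<open>Renorming\<close>

theorem theorem8:
  fixes G :: "('a::banach \<Rightarrow> 'a) set"
  assumes "separable_space (euclidean :: 'a topology)"
    and "isomorphism_group G"
    and "finite G"
    and "(\<lambda>x. - x) \<in> G"
  shows "\<exists>N. equivalent_norm N \<and> G = isometries N"
proof -
  interpret finite_operator_group G
    using assms(2-4) by (rule group_imp_finite_operator_group)
  show ?thesis
  proof (cases "\<exists>e::'a. \<forall>x. \<exists>c. x = c *\<^sub>R e")
    case True
    then obtain e :: 'a where "\<And>x. \<exists>c. x = c *\<^sub>R e" by blast
    then have "isometries (orbit_sum G norm) = G" by (rule isometries_of_spanned_space)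
    moreover have "norm_on (norm :: 'a \<Rightarrow> real)" by (simp add: norm_on_def norm_triangle_ineq)
    then have "equivalent_norm (orbit_sum G norm)"
      by (rule equivalent_orbit_sum[where B = 1]) auto
    ultimately show ?thesis by blast
  next
    case False
    obtain f :: "'a \<Rightarrow>\<^sub>L real"
      where f: "\<And>g h. g \<in> G \<Longrightarrow> h \<in> G \<Longrightarrow> g \<noteq> h \<Longrightarrow> \<exists>v. f (g v) \<noteq> f (h v)"
      using distinguishing_functional[OF assms(1)] by blast
    obtain e where e: "f e = 1"
    proof -
      obtain x :: 'a where "x \<noteq> 0" using False by (metis scaleR_zero_right)
      then have "x \<noteq> - x" by (metis eq_neg_iff_add_eq_0 scaleR_2 scaleR_eq_0_iff zero_neq_numeral)
      then have "(\<lambda>x::'a. x) \<noteq> (\<lambda>x. - x)" by metis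
      from f[OF id_G minus_G this] obtain v where "f v \<noteq> 0" by (auto simp: blinfun.minus_right)
      then show ?thesis using that[of "(1 / f v) *\<^sub>R v"] by (simp add: blinfun.scaleR_right)
    qed
    obtain x where x: "\<And>c. x \<noteq> c *\<^sub>R e" using False by metis
    obtain q :: "'a \<Rightarrow> real" where q: "norm_on q" "\<And>x. norm x / 2 \<le> q x" "\<And>x. q x \<le> norm x"
      "\<And>x v. x \<noteq> 0 \<Longrightarrow> (second_difference q x v \<longlongrightarrow> 0) (at_right 0)"
      using smooth_equivalent_norm[OF assms(1)] by blast
    define K where "K = norm f + 1"
    define L where "L = 2 * (1 + K) * bound_G"
    \<comment> \<open>\<open>P\<close> keeps the hyperplanes \<open>ker (\<phi> n \<circ> g)\<close> and \<open>ker (\<phi> m)\<close> apart when \<open>\<phi> m\<close> and \<open>\<phi> n\<close> are \<open>\<delta>\<close>-close to \<open>f\<close>, and \<open>Q\<close>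
keeps \<open>f \<circ> g\<close> and \<open>f \<circ> h\<close> apart. Both hold for all small \<open>\<delta>\<close>, because \<open>f\<close> distinguishes the elements of \<open>G\<close>.\<close>
    define P where "P \<delta> g \<longleftrightarrow> g \<noteq> (\<lambda>x. x) \<longrightarrow> g \<noteq> (\<lambda>x. - x) \<longrightarrow>
      (\<exists>y. f y = 0 \<and> \<delta> * (norm (g y) + norm y * (K * norm (g e))) < \<bar>f (g y)\<bar>)" for \<delta> g
    define Q where "Q \<delta> g h \<longleftrightarrow> g \<noteq> h \<longrightarrow> (\<exists>v. \<delta> * (2 * L * norm v) < \<bar>f (g v) - f (h v)\<bar>)"
      for \<delta> and g h :: "'a \<Rightarrow> 'a"
    have "\<forall>\<^sub>F \<delta> in at_right 0. P \<delta> g" if g: "g \<in> G" for g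
    proof (cases "g = (\<lambda>x. x) \<or> g = (\<lambda>x. - x)")
      case False
      then obtain y where y: "f y = 0" "f (g y) \<noteq> 0"
        using distinguishing_functional_kernel[OF f e g] by blast
      then show ?thesis
        using eventually_mult_less_at_right_0[of "\<bar>f (g y)\<bar>" "norm (g y) + norm y * (K * norm (g e))"]
        by (auto simp: P_def elim!: eventually_mono)
    qed (auto simp: P_def)
    moreover have "\<forall>\<^sub>F \<delta> in at_right 0. Q \<delta> g h" if gh: "g \<in> G" "h \<in> G" for g h
    proof (cases "g = h")
      case False
      then obtain v where v: "f (g v) \<noteq> f (h v)" using f[OF gh] by blast
      then show ?thesis
        using eventually_mult_less_at_right_0[of "\<bar>f (g v) - f (h v)\<bar>" "2 * L * norm v"]
        by (auto simp: Q_def elim!: eventually_mono)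
    qed (auto simp: Q_def)
    ultimately have "\<forall>\<^sub>F \<delta> in at_right 0. (\<forall>g\<in>G. P \<delta> g) \<and> (\<forall>g\<in>G. \<forall>h\<in>G. Q \<delta> g h) \<and> \<delta> * 1 < 1 \<and> 0 < \<delta>"
      using finite_G
      by (intro eventually_conj eventually_ball_finite ballI eventually_mult_less_at_right_0
          eventually_at_right_less) auto
    then obtain \<delta> where \<delta>: "\<And>g. g \<in> G \<Longrightarrow> P \<delta> g" "\<And>g h. g \<in> G \<Longrightarrow> h \<in> G \<Longrightarrow> Q \<delta> g h" "0 < \<delta>" "\<delta> < 1"
      using eventually_happens'[OF trivial_limit_at_right_real] by force
    obtain \<phi> :: "nat \<Rightarrow> 'a \<Rightarrow>\<^sub>L real" where \<phi>: "\<phi> 0 = f" "inj \<phi>" "\<And>n. \<phi> n e = 1"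
      "\<And>n. norm (\<phi> n - f) \<le> \<delta>" "\<And>x. (\<And>n. \<phi> n x = 0) \<Longrightarrow> x = 0"
      using close_separating_sequence[OF assms(1) e x \<delta>(3)] by blast
    have norm_\<phi>: "norm (\<phi> n) \<le> K" for n
      using norm_triangle_ineq2[of "\<phi> n" f] \<phi>(4)[of n] \<delta>(4) by (simp add: K_def)
    have close: "\<bar>\<phi> n v - f v\<bar> \<le> \<delta> * norm v" for n v
    proof -
      have "\<bar>\<phi> n v - f v\<bar> \<le> norm (\<phi> n - f) * norm v"
        using norm_blinfun[of "\<phi> n - f" v] by (simp add: blinfun.diff_left)
      also have "\<dots> \<le> \<delta> * norm v" by (intro mult_right_mono \<phi>(4)) simp
      finally show ?thesis .
    qed
    define c where "c = K * L * norm e"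
    have c: "0 \<le> c" using bound_G_nonneg by (simp add: c_def L_def K_def)
    define r where "r = min (1 / 2) (1 / (1 + c))"
    have r: "0 < r" "r \<le> 1 / 2" using c by (auto simp: r_def)
    have "r * c \<le> 1 / (1 + c) * c" using c by (intro mult_right_mono) (auto simp: r_def)
    also have "\<dots> < 1" using c by (simp add: divide_less_eq)
    finally have rc: "r * c < 1" .
    interpret kinked_norm_data G q \<phi> r K \<delta> e
    proof
      show "norm_on q" "norm x / 2 \<le> q x" "q x \<le> norm x" for x by (fact q)+
      show "(second_difference q x v \<longlongrightarrow> 0) (at_right 0)" if "x \<noteq> 0" for x v by (rule q(4)[OF that])
      show "norm (\<phi> n) \<le> K" for n by (rule norm_\<phi>)
      show "\<phi> n e = 1" for n by (rule \<phi>(3))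
      show "x = 0" if "\<And>n. \<phi> n x = 0" for x using that by (rule \<phi>(5))
      show "0 < r" "r \<le> 1 / 2" by (fact r)+
      show "r * (K * (2 * (1 + K) * bound_G) * norm e) < 1" using rc by (simp add: c_def L_def)
      show "norm (\<phi> n - \<phi> 0) \<le> \<delta>" for n by (simp add: \<phi>)
      show "g = h" if gh: "g \<in> G" "h \<in> G"
        and le: "\<And>v. \<bar>\<phi> 0 (g v) - \<phi> 0 (h v)\<bar> \<le> 2 * \<delta> * (2 * (1 + K) * bound_G) * norm v" for g h
      proof (rule ccontr)
        assume "g \<noteq> h"
        then obtain v where "\<delta> * (2 * L * norm v) < \<bar>f (g v) - f (h v)\<bar>"
          using \<delta>(2)[OF gh] \<open>g \<noteq> h\<close> by (auto simp: Q_def)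
        moreover have "2 * \<delta> * (2 * (1 + K) * bound_G) * norm v = \<delta> * (2 * L * norm v)"
          unfolding L_def by (simp only: mult.assoc mult.left_commute)
        ultimately show False using le[of v] by (simp only: \<phi>(1))
      qed
      fix g m n assume g: "g \<in> G" and ker: "\<And>y. \<phi> m y = 0 \<Longrightarrow> \<phi> n (g y) = 0"
      have kernel: "\<phi> n (g (y - \<phi> m y *\<^sub>R e)) = 0" for y
        by (rule ker) (simp add: \<phi>(3) blinfun.diff_right blinfun.scaleR_right)
      have factor: "\<phi> n (g y) = \<phi> m y * \<phi> n (g e)" for y
        using kernel[of y] linear_G[OF g]
        by (simp add: linear_diff linear_cmul blinfun.diff_right blinfun.scaleR_right)
      have g_cases: "g = (\<lambda>x. x) \<or> g = (\<lambda>x. - x)"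
      proof (rule ccontr)
        assume "\<not> ?thesis"
        then obtain y where y: "f y = 0" "\<delta> * (norm (g y) + norm y * (K * norm (g e))) < \<bar>f (g y)\<bar>"
          using \<delta>(1)[OF g] by (auto simp: P_def)
        have "\<bar>\<phi> n (g e)\<bar> \<le> norm (\<phi> n) * norm (g e)" using norm_blinfun[of "\<phi> n" "g e"] by simp
        also have "\<dots> \<le> K * norm (g e)" by (intro mult_right_mono norm_\<phi>) simp
        finally have 1: "\<bar>\<phi> n (g e)\<bar> \<le> K * norm (g e)" .
        have "\<bar>\<phi> n (g y)\<bar> \<le> (\<delta> * norm y) * (K * norm (g e))"
          unfolding factor[of y] abs_mult using close[of m y] y(1) 1 \<delta>(3) by (intro mult_mono) auto
        moreover have "\<bar>f (g y)\<bar> \<le> \<bar>\<phi> n (g y)\<bar> + \<delta> * norm (g y)"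
          using close[of n "g y"] by linarith
        ultimately show False using y(2) by (simp add: algebra_simps)
      qed
      then have "\<phi> n v = \<phi> m v" for v
        using factor[of v] factor[of e] \<phi>(3) by (auto simp: blinfun.minus_right)
      then have "\<phi> m = \<phi> n" by (simp add: blinfun_eqI)
      then show "m = n \<and> (g = (\<lambda>x. x) \<or> g = (\<lambda>x. - x))"
        using \<phi>(2) g_cases by (auto dest: injD)
    qed
    show ?thesis using equivalent_norm_N isometries_eq_G by blast
  qed
qed

end
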